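(* Let $1\le p<2$. There are spectral measures $E_1$, $E_2$ and $E_3$ on Borel subsets of $\mathbb R$ (acting on a Hilbert space $\mathcal H$), a function $\Psi$ in the Haagerup tensor product $L^\infty(E_1)\otimes_{\rm h}L^\infty(E_2)\otimes_{\rm h}L^\infty(E_3)$ and an operator $Q\in\boldsymbol S_p$ such that $$\iiint\Psi(x_1,x_2,x_3)\,dE_1(x_1)\,dE_2(x_2)\,Q\,dE_3(x_3)\notin\boldsymbol S_p.$$
   Context: $\boldsymbol S_p$ is the Schatten--von Neumann class of operators on $\mathcal H$. A spectral measure is a countably additive measure whose values are orthogonal projections on $\mathcal H$ and whose value on the whole space is $I$. Notation. $\mathcal B$ is the space of infinite matrices $\{b_{jk}\}_{j,k\ge0}$ that induce bounded linear operators on $\ell^2$, with the operator norm. $\{\alpha_j\}_{j\ge0}\in L^\infty(\ell^2)$ means that the $\alpha_j$ are measurable and $\operatorname{ess\,sup}_x\big(\sum_j|\alpha_j(x)|^2\big)^{1/2}<\infty$; $\{\beta_{jk}\}_{j,k\ge0}\in L^\infty(\mathcal B)$ means that the $\beta_{jk}$ are measurable and $\operatorname{ess\,sup}_x\|\{\beta_{jk}(x)\}_{j,k\ge0}\|_{\mathcal B}<\infty$ (essential suprema with respect to the corresponding spectral measure). Haagerup tensor product. $L^\infty(E_1)\otimes_{\rm h}L^\infty(E_2)\otimes_{\rm h}L^\infty(E_3)$ consists of the functions $\Psi$ that admit a representation $$\Psi(x_1,x_2,x_3)=\sum_{j,k\ge0}\alpha_j(x_1)\beta_{jk}(x_2)\gamma_k(x_3),$$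 with $\{\alpha_j\}_{j\ge0}\in L^\infty(\ell^2)$ (over $E_1$), $\{\gamma_k\}_{k\ge0}\in L^\infty(\ell^2)$ (over $E_3$), $\{\beta_{jk}\}_{j,k\ge0}\in L^\infty(\mathcal B)$ (over $E_2$). Triple operator integral. For such $\Psi$ and bounded operators $T,R$ on $\mathcal H$, $$\iiint\Psi\,dE_1(x_1)\,T\,dE_2(x_2)\,R\,dE_3(x_3)=\sum_{j,k\ge0}\Big(\int\alpha_j\,dE_1\Big)T\Big(\int\beta_{jk}\,dE_2\Big)R\Big(\int\gamma_k\,dE_3\Big),$$ the limit in the weak operator topology of the partial sums over $0\le j\le M$, $0\le k\le N$ as $M,N\to\infty$; it is a bounded operator that does not depend on the representation of $\Psi$. The integral in the claim is the case $T=I$, $R=Q$. *)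

theory Defs
  imports "HOL-Analysis.Analysis" "HOL-Library.Function_Algebras"
begin

section \<open>Complex Hilbert spaces\<close>

text \<open>HOL-Analysis only has real inner product spaces. A complex Hilbert space is given here by
  a linear subspace \<open>vecs H\<close> of an ambient complex vector space together with an inner product
  \<open>ip H\<close> on it, which is linear in the first argument and unrelated to any topology of the
  ambient space. Such structures can be existentially quantified, unlike types. Operators are
  functions on the ambient type of which only the restriction to \<open>vecs H\<close> matters.\<close>

record 'v hilbert =
  vecs :: "'v set"
  scl :: "complex \<Rightarrow> 'v \<Rightarrow> 'v"
  ip :: "'v \<Rightarrow> 'v \<Rightarrow> complex"

definition hnorm :: "'v hilbert \<Rightarrow> 'v \<Rightarrow> real" where
  "hnorm H u = sqrt (Re (ip H u u))"

locale hilbert_space =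
  fixes H :: "'v::ab_group_add hilbert"
  assumes vector_space: "vector_space (scl H)"
    and subspace: "module.subspace (scl H) (vecs H)"
    and ip_add: "\<lbrakk>u \<in> vecs H; v \<in> vecs H; w \<in> vecs H\<rbrakk> \<Longrightarrow> ip H (u + v) w = ip H u w + ip H v w"
    and ip_scl: "\<lbrakk>u \<in> vecs H; v \<in> vecs H\<rbrakk> \<Longrightarrow> ip H (scl H c u) v = c * ip H u v"
    and ip_cnj: "\<lbrakk>u \<in> vecs H; v \<in> vecs H\<rbrakk> \<Longrightarrow> ip H v u = cnj (ip H u v)"
    and ip_pos: "\<lbrakk>u \<in> vecs H; u \<noteq> 0\<rbrakk> \<Longrightarrow> 0 < Re (ip H u u)"
    and complete: "Metric_space.mcomplete (vecs H) (\<lambda>u v. hnorm H (u - v))"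


section \<open>Bounded operators and Schatten--von Neumann classes\<close>

definition bounded_op :: "'v::ab_group_add hilbert \<Rightarrow> ('v \<Rightarrow> 'v) \<Rightarrow> bool" where
  "bounded_op H T \<longleftrightarrow>
     (\<forall>u\<in>vecs H. T u \<in> vecs H) \<and>
     (\<forall>u\<in>vecs H. \<forall>v\<in>vecs H. T (u + v) = T u + T v) \<and>
     (\<forall>c. \<forall>u\<in>vecs H. T (scl H c u) = scl H c (T u)) \<and>
     (\<exists>C. \<forall>u\<in>vecs H. hnorm H (T u) \<le> C * hnorm H u)"

definition op_norm :: "'v hilbert \<Rightarrow> ('v \<Rightarrow> 'v) \<Rightarrow> real" where
  "op_norm H T = Sup {hnorm H (T u) | u. u \<in> vecs H \<and> hnorm H u \<le> 1}"

definition rank_le :: "'v::ab_group_add hilbert \<Rightarrow> ('v \<Rightarrow> 'v) \<Rightarrow> nat \<Rightarrow> bool" where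
  "rank_le H T n \<longleftrightarrow>
     (\<exists>B. finite B \<and> card B \<le> n \<and> B \<subseteq> vecs H \<and> T ` vecs H \<subseteq> module.span (scl H) B)"

definition singular_value :: "'v::ab_group_add hilbert \<Rightarrow> ('v \<Rightarrow> 'v) \<Rightarrow> nat \<Rightarrow> real" where
  "singular_value H T n =
     Inf {op_norm H (\<lambda>u. T u - K u) | K. bounded_op H K \<and> rank_le H K n}"

definition Schatten :: "'v::ab_group_add hilbert \<Rightarrow> real \<Rightarrow> ('v \<Rightarrow> 'v) set" where
  "Schatten H p = {T. bounded_op H T \<and> summable (\<lambda>n. singular_value H T n powr p)}"


section \<open>Spectral measures on the Borel subsets of the real line\<close>

definition orth_projection :: "'v::ab_group_add hilbert \<Rightarrow> ('v \<Rightarrow> 'v) \<Rightarrow> bool" where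
  "orth_projection H P \<longleftrightarrow>
     bounded_op H P \<and> (\<forall>u\<in>vecs H. P (P u) = P u) \<and>
     (\<forall>u\<in>vecs H. \<forall>v\<in>vecs H. ip H (P u) v = ip H u (P v))"

text \<open>Countable additivity is meant in the strong operator topology.\<close>

definition spectral_measure ::
    "'v::ab_group_add hilbert \<Rightarrow> (real set \<Rightarrow> 'v \<Rightarrow> 'v) \<Rightarrow> bool" where
  "spectral_measure H E \<longleftrightarrow>
     (\<forall>S\<in>sets borel. orth_projection H (E S)) \<and>
     (\<forall>u\<in>vecs H. E UNIV u = u) \<and>
     (\<forall>A :: nat \<Rightarrow> real set. range A \<subseteq> sets borel \<longrightarrow> disjoint_family A \<longrightarrow>
        (\<forall>u\<in>vecs H. (\<lambda>n. hnorm H ((\<Sum>i<n. E (A i) u) - E (\<Union>i. A i) u)) \<longlonglongrightarrow> 0))"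

definition spectral_null :: "'v::ab_group_add hilbert \<Rightarrow> (real set \<Rightarrow> 'v \<Rightarrow> 'v) \<Rightarrow> real set set" where
  "spectral_null H E = {N \<in> sets borel. \<forall>u\<in>vecs H. E N u = 0}"

definition spectral_ae ::
    "'v::ab_group_add hilbert \<Rightarrow> (real set \<Rightarrow> 'v \<Rightarrow> 'v) \<Rightarrow> (real \<Rightarrow> bool) \<Rightarrow> bool" where
  "spectral_ae H E P \<longleftrightarrow> (\<exists>N\<in>spectral_null H E. \<forall>x. x \<notin> N \<longrightarrow> P x)"

definition spectral_distr :: "'v hilbert \<Rightarrow> (real set \<Rightarrow> 'v \<Rightarrow> 'v) \<Rightarrow> 'v \<Rightarrow> real measure" where
  "spectral_distr H E u = measure_of UNIV (sets borel) (\<lambda>S. ennreal (Re (ip H (E S u) u)))"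

text \<open>The integral of \<open>\<phi>\<close> with respect to the complex measure \<open>S \<mapsto> \<langle>E S u, v\<rangle>\<close>, which by
  polarization is a linear combination of the finite positive measures
  \<open>S \<mapsto> \<langle>E S w, w\<rangle>\<close> with \<open>w = u + \<i>\<^sup>k v\<close>.\<close>

definition spectral_form ::
    "'v::ab_group_add hilbert \<Rightarrow> (real set \<Rightarrow> 'v \<Rightarrow> 'v) \<Rightarrow> (real \<Rightarrow> complex) \<Rightarrow> 'v \<Rightarrow> 'v \<Rightarrow> complex" where
  "spectral_form H E \<phi> u v =
     (1 / 4) * (\<Sum>k<4. \<i> ^ k * (LINT x|spectral_distr H E (u + scl H (\<i> ^ k) v). \<phi> x))"

text \<open>The operator \<open>\<integral>\<phi> dE\<close>, determined by \<open>\<langle>(\<integral>\<phi> dE) u, v\<rangle> = \<integral>\<phi> d\<langle>E u, v\<rangle>\<close>. It is only used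
  for \<open>\<phi>\<close> measurable and \<open>E\<close>-essentially bounded, where it exists.\<close>

definition spectral_integral ::
    "'v::ab_group_add hilbert \<Rightarrow> (real set \<Rightarrow> 'v \<Rightarrow> 'v) \<Rightarrow> (real \<Rightarrow> complex) \<Rightarrow> 'v \<Rightarrow> 'v" where
  "spectral_integral H E \<phi> u =
     (THE w. w \<in> vecs H \<and> (\<forall>v\<in>vecs H. ip H w v = spectral_form H E \<phi> u v))"


section \<open>Square summable sequences and bounded infinite matrices\<close>

definition l2 :: "(nat \<Rightarrow> complex) set" where
  "l2 = {z. summable (\<lambda>n. (cmod (z n))\<^sup>2)}"

definition l2_norm :: "(nat \<Rightarrow> complex) \<Rightarrow> real" where
  "l2_norm z = sqrt (\<Sum>n. (cmod (z n))\<^sup>2)"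

definition mat_app :: "(nat \<Rightarrow> nat \<Rightarrow> complex) \<Rightarrow> (nat \<Rightarrow> complex) \<Rightarrow> nat \<Rightarrow> complex" where
  "mat_app b z = (\<lambda>j. \<Sum>k. b j k * z k)"

definition bounded_matrices :: "(nat \<Rightarrow> nat \<Rightarrow> complex) set" where
  "bounded_matrices =
     {b. (\<forall>z\<in>l2. (\<forall>j. summable (\<lambda>k. b j k * z k)) \<and> mat_app b z \<in> l2) \<and>
         (\<exists>C. \<forall>z\<in>l2. l2_norm (mat_app b z) \<le> C * l2_norm z)}"

definition matrix_norm :: "(nat \<Rightarrow> nat \<Rightarrow> complex) \<Rightarrow> real" where
  "matrix_norm b = Sup {l2_norm (mat_app b z) | z. z \<in> l2 \<and> l2_norm z \<le> 1}"

definition Linf_l2 ::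
    "'v::ab_group_add hilbert \<Rightarrow> (real set \<Rightarrow> 'v \<Rightarrow> 'v) \<Rightarrow> (nat \<Rightarrow> real \<Rightarrow> complex) set" where
  "Linf_l2 H E =
     {\<alpha>. (\<forall>j. \<alpha> j \<in> borel_measurable borel) \<and>
         (\<exists>C. spectral_ae H E (\<lambda>x. (\<lambda>j. \<alpha> j x) \<in> l2 \<and> l2_norm (\<lambda>j. \<alpha> j x) \<le> C))}"

definition Linf_matrices ::
    "'v::ab_group_add hilbert \<Rightarrow> (real set \<Rightarrow> 'v \<Rightarrow> 'v) \<Rightarrow> (nat \<Rightarrow> nat \<Rightarrow> real \<Rightarrow> complex) set" where
  "Linf_matrices H E =
     {\<beta>. (\<forall>j k. \<beta> j k \<in> borel_measurable borel) \<and>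
         (\<exists>C. spectral_ae H E
            (\<lambda>x. (\<lambda>j k. \<beta> j k x) \<in> bounded_matrices \<and> matrix_norm (\<lambda>j k. \<beta> j k x) \<le> C))}"


section \<open>Haagerup tensor product and triple operator integrals\<close>

text \<open>The double series is the limit of its rectangular partial sums (it need not converge
  absolutely). As the coefficient functions are only essentially bounded, the representation is
  required for all \<open>x\<^sub>1\<close>, \<open>x\<^sub>2\<close>, \<open>x\<^sub>3\<close> outside null sets of the respective spectral measures.\<close>

definition haagerup_representation ::
    "'v::ab_group_add hilbert \<Rightarrow>
     (real set \<Rightarrow> 'v \<Rightarrow> 'v) \<Rightarrow> (real set \<Rightarrow> 'v \<Rightarrow> 'v) \<Rightarrow> (real set \<Rightarrow> 'v \<Rightarrow> 'v) \<Rightarrow>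
     (real \<Rightarrow> real \<Rightarrow> real \<Rightarrow> complex) \<Rightarrow>
     (nat \<Rightarrow> real \<Rightarrow> complex) \<Rightarrow> (nat \<Rightarrow> nat \<Rightarrow> real \<Rightarrow> complex) \<Rightarrow> (nat \<Rightarrow> real \<Rightarrow> complex) \<Rightarrow> bool" where
  "haagerup_representation H E1 E2 E3 \<Psi> \<alpha> \<beta> \<gamma> \<longleftrightarrow>
     \<alpha> \<in> Linf_l2 H E1 \<and> \<beta> \<in> Linf_matrices H E2 \<and> \<gamma> \<in> Linf_l2 H E3 \<and>
     (\<exists>N1\<in>spectral_null H E1. \<exists>N2\<in>spectral_null H E2. \<exists>N3\<in>spectral_null H E3.
        \<forall>x1 x2 x3. x1 \<notin> N1 \<longrightarrow> x2 \<notin> N2 \<longrightarrow> x3 \<notin> N3 \<longrightarrow>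
          ((\<lambda>(M, N). \<Sum>j\<le>M. \<Sum>k\<le>N. \<alpha> j x1 * \<beta> j k x2 * \<gamma> k x3) \<longlongrightarrow> \<Psi> x1 x2 x3)
            (sequentially \<times>\<^sub>F sequentially))"

definition haagerup_tensor ::
    "'v::ab_group_add hilbert \<Rightarrow>
     (real set \<Rightarrow> 'v \<Rightarrow> 'v) \<Rightarrow> (real set \<Rightarrow> 'v \<Rightarrow> 'v) \<Rightarrow> (real set \<Rightarrow> 'v \<Rightarrow> 'v) \<Rightarrow>
     (real \<Rightarrow> real \<Rightarrow> real \<Rightarrow> complex) set" where
  "haagerup_tensor H E1 E2 E3 = {\<Psi>. \<exists>\<alpha> \<beta> \<gamma>. haagerup_representation H E1 E2 E3 \<Psi> \<alpha> \<beta> \<gamma>}"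

text \<open>\<open>has_triple_integral H E1 T E2 R E3 \<Psi> W\<close> states that
  \<open>\<integral>\<integral>\<integral> \<Psi>(x\<^sub>1,x\<^sub>2,x\<^sub>3) dE1(x\<^sub>1) T dE2(x\<^sub>2) R dE3(x\<^sub>3) = W\<close>. The value on \<open>vecs H\<close> does not depend on the
  chosen representation of \<open>\<Psi>\<close>.\<close>

definition has_triple_integral ::
    "'v::ab_group_add hilbert \<Rightarrow>
     (real set \<Rightarrow> 'v \<Rightarrow> 'v) \<Rightarrow> ('v \<Rightarrow> 'v) \<Rightarrow> (real set \<Rightarrow> 'v \<Rightarrow> 'v) \<Rightarrow> ('v \<Rightarrow> 'v) \<Rightarrow>
     (real set \<Rightarrow> 'v \<Rightarrow> 'v) \<Rightarrow> (real \<Rightarrow> real \<Rightarrow> real \<Rightarrow> complex) \<Rightarrow> ('v \<Rightarrow> 'v) \<Rightarrow> bool" where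
  "has_triple_integral H E1 T E2 R E3 \<Psi> W \<longleftrightarrow>
     bounded_op H W \<and>
     (\<exists>\<alpha> \<beta> \<gamma>. haagerup_representation H E1 E2 E3 \<Psi> \<alpha> \<beta> \<gamma> \<and>
        (\<forall>u\<in>vecs H. \<forall>v\<in>vecs H.
           ((\<lambda>(M, N). ip H (\<Sum>j\<le>M. \<Sum>k\<le>N.
               spectral_integral H E1 (\<alpha> j) (T (spectral_integral H E2 (\<beta> j k)
                 (R (spectral_integral H E3 (\<gamma> k) u))))) v) \<longlongrightarrow> ip H (W u) v)
             (sequentially \<times>\<^sub>F sequentially)))"

end

theory Submission imports Defs begin

text \<open>Let \<open>E1 = E3\<close> be the spectral measure of the standard basis \<open>e\<^sub>j\<close> of \<open>l2\<close>, and \<open>E2\<close> the one of the basis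
  formed by the columns of a block diagonal real symmetric orthogonal matrix \<open>U\<close> whose blocks
  have entries of constant modulus. The symbol
  \<open>\<Sum>\<^sub>j 1\<^sub>j(x\<^sub>1) sgn U\<^sub>j(x\<^sub>2) 1\<^sub>j(x\<^sub>3)\<close> has a diagonal middle factor, and applied to the rank one operator
  \<open>Q u = \<langle>u, q\<rangle> U q\<close> it gives the diagonal operator with eigenvalues \<open>q\<^sub>j \<Sum>\<^sub>n |U\<^sub>j\<^sub>n| q\<^sub>n\<close>. On a block of
  size \<open>N\<close> the inner sum is about \<open>N\<^sup>1\<^sup>/\<^sup>2 q\<^sub>N\<close>, because all signs have been removed; for \<open>q\<close> barely
  square summable these eigenvalues are square summable but not \<open>p\<close>-summable.\<close>

section \<open>The sequence space\<close>

text \<open>Norms are bounded through finite sections: \<open>L2_set\<close> brings the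
  finite-dimensional triangle and Cauchy-Schwarz inequalities with it, and one uniform bound gives
  both membership in \<open>l2\<close> and the norm estimate.\<close>

lemma l2_boundI:
  assumes "\<And>N. L2_set (\<lambda>n. cmod (z n)) {..<N} \<le> C"
  shows "z \<in> l2" "l2_norm z \<le> C"
proof -
  have C: "0 \<le> C" using assms[of 0] by simp
  have le: "(\<Sum>n<N. (cmod (z n))\<^sup>2) \<le> C\<^sup>2" for N
    using assms[of N] C unfolding L2_set_def by (metis real_sqrt_le_iff real_sqrt_abs abs_of_nonneg)
  show "z \<in> l2" unfolding l2_def using summableI_nonneg_bounded[OF _ le] by simp
  then show "l2_norm z \<le> C"
    unfolding l2_norm_def l2_def using C le by (intro real_le_lsqrt suminf_le_const) auto
qed

lemma L2_set_le_l2_norm: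
  assumes "z \<in> l2" "finite A"
  shows "L2_set (\<lambda>n. cmod (z n)) A \<le> l2_norm z"
  using assms unfolding l2_def l2_norm_def L2_set_def by (auto intro!: sum_le_suminf)

lemma cmod_le_l2_norm: "z \<in> l2 \<Longrightarrow> cmod (z n) \<le> l2_norm z"
  using L2_set_le_l2_norm[of z "{n}"] by simp

lemma l2_norm_nonneg: "z \<in> l2 \<Longrightarrow> 0 \<le> l2_norm z"
  using cmod_le_l2_norm[of z 0] norm_ge_zero order_trans by blast

lemma l2_dominated:
  assumes "u \<in> l2" "0 \<le> C" "\<And>n. cmod (v n) \<le> C * cmod (u n)"
  shows "v \<in> l2" "l2_norm v \<le> C * l2_norm u"
proof -
  have "L2_set (\<lambda>n. cmod (v n)) {..<N} \<le> C * l2_norm u" for N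
  proof -
    have "L2_set (\<lambda>n. cmod (v n)) {..<N} \<le> L2_set (\<lambda>n. C * cmod (u n)) {..<N}"
      using assms by (intro L2_set_mono) auto
    also have "\<dots> = C * L2_set (\<lambda>n. cmod (u n)) {..<N}"
      using assms by (simp add: L2_set_right_distrib)
    also have "\<dots> \<le> C * l2_norm u"
      using assms by (intro mult_left_mono L2_set_le_l2_norm) auto
    finally show ?thesis .
  qed
  then show "v \<in> l2" "l2_norm v \<le> C * l2_norm u" by (rule l2_boundI)+
qed

lemma l2_add:
  assumes "u \<in> l2" "v \<in> l2"
  shows "u + v \<in> l2" "l2_norm (u + v) \<le> l2_norm u + l2_norm v"
proof -
  have "L2_set (\<lambda>n. cmod ((u + v) n)) {..<N} \<le> l2_norm u + l2_norm v" for N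
  proof -
    have "L2_set (\<lambda>n. cmod ((u + v) n)) {..<N} \<le> L2_set (\<lambda>n. cmod (u n) + cmod (v n)) {..<N}"
      by (intro L2_set_mono) (auto simp: norm_triangle_ineq)
    also have "\<dots> \<le> L2_set (\<lambda>n. cmod (u n)) {..<N} + L2_set (\<lambda>n. cmod (v n)) {..<N}"
      by (rule L2_set_triangle_ineq)
    also have "\<dots> \<le> l2_norm u + l2_norm v"
      using assms by (intro add_mono L2_set_le_l2_norm) auto
    finally show ?thesis .
  qed
  then show "u + v \<in> l2" "l2_norm (u + v) \<le> l2_norm u + l2_norm v" by (rule l2_boundI)+
qed

lemma l2_zero: "0 \<in> l2" "l2_norm 0 = 0"
  by (auto simp: l2_def l2_norm_def)

lemma l2_bounded_mult:
  assumes "u \<in> l2" "\<And>n. cmod (b n) \<le> C"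
  shows "(\<lambda>n. b n * u n) \<in> l2" "l2_norm (\<lambda>n. b n * u n) \<le> C * l2_norm u"
proof -
  have "0 \<le> C" using assms(2)[of 0] norm_ge_zero order_trans by blast
  then show "(\<lambda>n. b n * u n) \<in> l2" "l2_norm (\<lambda>n. b n * u n) \<le> C * l2_norm u"
    using assms by (auto intro!: l2_dominated[of u C] mult_right_mono simp: norm_mult)
qed

lemma l2_scale: "u \<in> l2 \<Longrightarrow> (\<lambda>n. c * u n) \<in> l2"
  by (rule l2_bounded_mult) auto

lemma l2_uminus: "u \<in> l2 \<Longrightarrow> - u \<in> l2" "u \<in> l2 \<Longrightarrow> l2_norm (- u) = l2_norm u"
  by (auto simp: l2_def l2_norm_def)

lemma l2_diff:
  assumes "u \<in> l2" "v \<in> l2"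
  shows "u - v \<in> l2" "l2_norm (u - v) \<le> l2_norm u + l2_norm v"
  using l2_add[of u "- v"] l2_uminus[of v] assms by auto

lemma l2_sum: "(\<And>i. i \<in> I \<Longrightarrow> f i \<in> l2) \<Longrightarrow> (\<Sum>i\<in>I. f i) \<in> l2"
  by (induction I rule: infinite_finite_induct) (auto simp: l2_zero l2_add)

lemma sum_fun_eval: "(\<Sum>i\<in>I. f i) n = (\<Sum>i\<in>I. f i n)"
  for f :: "'i \<Rightarrow> 'n \<Rightarrow> 'c::comm_monoid_add"
  by (induction I rule: infinite_finite_induct) auto

lemma l2_norm_eq_0: "u \<in> l2 \<Longrightarrow> l2_norm u = 0 \<longleftrightarrow> u = 0"
  using cmod_le_l2_norm[of u] l2_zero by fastforce

text \<open>The value of \<open>ip\<close> off \<open>l2\<close> matters: \<open>Metric_space\<close> requires distances to be nonnegative on the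
  whole type, and a divergent \<open>suminf\<close> has no known sign.\<close>

definition ell2 :: "(nat \<Rightarrow> complex) hilbert" where
  "ell2 = \<lparr>vecs = l2, scl = (\<lambda>c u n. c * u n), ip = (\<lambda>u v. if u \<in> l2 \<and> v \<in> l2 then \<Sum>n. u n * cnj (v n) else 0)\<rparr>"

lemma ell2_sel [simp]:
  "vecs ell2 = l2" "scl ell2 c u = (\<lambda>n. c * u n)" "u \<in> l2 \<Longrightarrow> v \<in> l2 \<Longrightarrow> ip ell2 u v = (\<Sum>n. u n * cnj (v n))"
  by (auto simp: ell2_def)

lemma summable_ip:
  assumes "u \<in> l2" "v \<in> l2"
  shows "summable (\<lambda>n. u n * cnj (v n))" "summable (\<lambda>n. cmod (u n * cnj (v n)))"
proof -
  have *: "norm (cmod (u n * cnj (v n))) \<le> (cmod (u n))\<^sup>2 + (cmod (v n))\<^sup>2" for n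
  proof -
    have "2 * cmod (u n) * cmod (v n) \<le> (cmod (u n))\<^sup>2 + (cmod (v n))\<^sup>2"
      by (rule sum_squares_bound)
    moreover have "0 \<le> cmod (u n) * cmod (v n)" by simp
    ultimately show ?thesis unfolding norm_mult complex_mod_cnj real_norm_def abs_mult abs_norm_cancel by linarith
  qed
  show "summable (\<lambda>n. cmod (u n * cnj (v n)))"
    by (rule summable_comparison_test[OF _ summable_add[of "\<lambda>n. (cmod (u n))\<^sup>2" "\<lambda>n. (cmod (v n))\<^sup>2"]])
      (use * assms in \<open>auto simp: l2_def\<close>)
  then show "summable (\<lambda>n. u n * cnj (v n))" by (rule summable_norm_cancel)
qed

lemma suminf_cnj: "summable f \<Longrightarrow> (\<Sum>n. cnj (f n)) = cnj (\<Sum>n. f n)"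
  by (metis sums_cnj sums_unique summable_sums)

lemma Re_ip_self:
  assumes "u \<in> l2"
  shows "Re (\<Sum>n. u n * cnj (u n)) = (\<Sum>n. (cmod (u n))\<^sup>2)"
proof -
  have "(\<Sum>n. u n * cnj (u n)) = (\<Sum>n. complex_of_real ((cmod (u n))\<^sup>2))"
    by (simp only: complex_norm_square)
  also have "\<dots> = of_real (\<Sum>n. (cmod (u n))\<^sup>2)"
    using assms by (simp add: l2_def suminf_of_real)
  finally show ?thesis by simp
qed

lemma hnorm_ell2 [simp]: "u \<in> l2 \<Longrightarrow> hnorm ell2 u = l2_norm u"
  using Re_ip_self by (simp add: hnorm_def l2_norm_def)

section \<open>Completeness and the Hilbert space axioms\<close>

lemma Metric_space_l2: "Metric_space l2 (\<lambda>u v. hnorm ell2 (u - v))"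
proof
  fix x y z :: "nat \<Rightarrow> complex"
  \<comment> \<open>Nonnegativity and symmetry are demanded for all functions, so
    \<open>hnorm\<close> must be evaluated off \<open>l2\<close> as well; it is 0 there because
    \<open>ip\<close> is.\<close>
  have "hnorm ell2 u = (if u \<in> l2 then l2_norm u else 0)" for u
    by (simp add: hnorm_def ell2_def flip: hnorm_ell2)
  then show "0 \<le> hnorm ell2 (x - y)" "hnorm ell2 (x - y) = hnorm ell2 (y - x)"
    using l2_uminus[of "x - y"] l2_uminus[of "y - x"] by (auto simp: l2_norm_nonneg)
next
  fix x y z :: "nat \<Rightarrow> complex"
  assume "x \<in> l2" "y \<in> l2" "z \<in> l2"
  then show "hnorm ell2 (x - y) = 0 \<longleftrightarrow> x = y"
    and "hnorm ell2 (x - z) \<le> hnorm ell2 (x - y) + hnorm ell2 (y - z)"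
    using l2_add(2)[of "x - y" "y - z"] by (simp_all add: l2_norm_eq_0 l2_diff)
qed

text \<open>The limit \<open>L\<close> is taken coordinatewise. Each finite section of
  \<open>\<sigma> n - L\<close> inherits the Cauchy bound, as finite sums commute with the limit in
  \<open>n'\<close>, so \<open>L\<close> lies in \<open>l2\<close> and is also the limit in
  norm.\<close>

lemma l2_mcomplete: "Metric_space.mcomplete l2 (\<lambda>u v. hnorm ell2 (u - v))"
proof -
  interpret l2_metric: Metric_space l2 "\<lambda>u v. hnorm ell2 (u - v)" by (rule Metric_space_l2)
  show ?thesis
    unfolding l2_metric.mcomplete_def
  proof (intro allI impI)
    fix \<sigma> assume "l2_metric.MCauchy \<sigma>"
    then have \<sigma>: "\<And>i. \<sigma> i \<in> l2"
      and C: "\<And>e. e > 0 \<Longrightarrow> \<exists>N. \<forall>n n'. N \<le> n \<longrightarrow> N \<le> n' \<longrightarrow> l2_norm (\<sigma> n - \<sigma> n') < e"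
      unfolding l2_metric.MCauchy_def by (auto simp: l2_diff range_subsetD)
    have "Cauchy (\<lambda>i. \<sigma> i k)" for k
    proof (rule metric_CauchyI)
      fix e :: real assume "e > 0"
      then obtain N where N: "\<And>n n'. N \<le> n \<Longrightarrow> N \<le> n' \<Longrightarrow> l2_norm (\<sigma> n - \<sigma> n') < e"
        using C by blast
      have "dist (\<sigma> n k) (\<sigma> n' k) < e" if "N \<le> n" "N \<le> n'" for n n'
        using cmod_le_l2_norm[of "\<sigma> n - \<sigma> n'" k] N[OF that] \<sigma> by (simp add: l2_diff dist_norm)
      then show "\<exists>M. \<forall>m\<ge>M. \<forall>n\<ge>M. dist (\<sigma> m k) (\<sigma> n k) < e" by blast
    qed
    then have "\<forall>k. \<exists>l. (\<lambda>i. \<sigma> i k) \<longlonglongrightarrow> l"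
      by (simp add: Cauchy_convergent_iff convergent_def)
    then obtain L where L: "\<And>k. (\<lambda>i. \<sigma> i k) \<longlonglongrightarrow> L k"
      by metis
    have close: "\<sigma> n - L \<in> l2 \<and> l2_norm (\<sigma> n - L) \<le> e"
      if N: "\<And>n'. N \<le> n' \<Longrightarrow> l2_norm (\<sigma> n - \<sigma> n') < e" for e N n
    proof -
      have "L2_set (\<lambda>k. cmod ((\<sigma> n - L) k)) {..<K} \<le> e" for K
      proof (rule LIMSEQ_le_const2)
        show "(\<lambda>n'. L2_set (\<lambda>k. cmod ((\<sigma> n - \<sigma> n') k)) {..<K}) \<longlonglongrightarrow> L2_set (\<lambda>k. cmod ((\<sigma> n - L) k)) {..<K}"
          unfolding L2_set_def minus_apply by (intro tendsto_real_sqrt tendsto_sum tendsto_power tendsto_norm tendsto_diff tendsto_const L)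
        show "\<exists>N. \<forall>n'\<ge>N. L2_set (\<lambda>k. cmod ((\<sigma> n - \<sigma> n') k)) {..<K} \<le> e"
        proof (intro exI[of _ N] allI impI)
          fix n' assume "N \<le> n'"
          have "L2_set (\<lambda>k. cmod ((\<sigma> n - \<sigma> n') k)) {..<K} \<le> l2_norm (\<sigma> n - \<sigma> n')"
            by (intro L2_set_le_l2_norm l2_diff \<sigma>) simp
          then show "L2_set (\<lambda>k. cmod ((\<sigma> n - \<sigma> n') k)) {..<K} \<le> e"
            using N[OF \<open>N \<le> n'\<close>] by linarith
        qed
      qed
      then show ?thesis using l2_boundI by blast
    qed
    have "L \<in> l2"
    proof -
      obtain N where "\<And>n'. N \<le> n' \<Longrightarrow> l2_norm (\<sigma> N - \<sigma> n') < 1" using C[of 1] by auto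
      then have "\<sigma> N - L \<in> l2" using close by blast
      then show ?thesis using l2_diff(1)[OF \<sigma>[of N], of "\<sigma> N - L"] by simp
    qed
    moreover have "\<exists>N. \<forall>n\<ge>N. \<sigma> n \<in> l2 \<and> l2_norm (\<sigma> n - L) < e" if e: "e > 0" for e
    proof -
      obtain N where "\<And>n n'. N \<le> n \<Longrightarrow> N \<le> n' \<Longrightarrow> l2_norm (\<sigma> n - \<sigma> n') < e/2"
        using C[OF half_gt_zero[OF e]] by blast
      then have "\<forall>n\<ge>N. l2_norm (\<sigma> n - L) \<le> e/2" using close by blast
      then have "\<forall>n\<ge>N. l2_norm (\<sigma> n - L) < e" using e by fastforce
      then show ?thesis using \<sigma> by blast
    qed
    ultimately show "\<exists>x. limitin l2_metric.mtopology \<sigma> x sequentially"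
      unfolding l2_metric.limitin_metric eventually_sequentially by (metis \<sigma> hnorm_ell2 l2_diff(1))
  qed
qed

lemma hilbert_ell2: "hilbert_space ell2"
proof (rule hilbert_space.intro)
  show "Vector_Spaces.vector_space (scl ell2)"
    by unfold_locales (auto simp: algebra_simps)
  then show "module.subspace (scl ell2) (vecs ell2)"
  proof -
    interpret vector_space "scl ell2" by fact
    show ?thesis by (simp add: subspace_def l2_zero l2_add l2_scale)
  qed
next
  fix u v w :: "nat \<Rightarrow> complex" and c
  assume u: "u \<in> vecs ell2"
  show "u \<noteq> 0 \<Longrightarrow> 0 < Re (ip ell2 u u)"
    using u Re_ip_self[of u] l2_norm_eq_0[of u] l2_norm_nonneg[of u] by (auto simp: l2_norm_def less_le)
  assume v: "v \<in> vecs ell2"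
  show "ip ell2 (scl ell2 c u) v = c * ip ell2 u v"
    using u v summable_ip[of u v] by (simp add: suminf_mult mult.assoc l2_scale)
  show "ip ell2 v u = cnj (ip ell2 u v)"
    using u v summable_ip[of u v] by (simp add: suminf_cnj[symmetric] mult.commute)
  assume "w \<in> vecs ell2"
  then show "ip ell2 (u + v) w = ip ell2 u w + ip ell2 v w"
    using u v by (simp add: suminf_add summable_ip l2_add algebra_simps)
next
  show "Metric_space.mcomplete (vecs ell2) (\<lambda>u v. hnorm ell2 (u - v))"
    using l2_mcomplete by simp
qed

section \<open>A block Hadamard matrix\<close>

text \<open>The orthogonal matrix \<open>had\<close> is block diagonal with index blocks \<open>{0}\<close> and \<open>{2^k..<2^(k+1)}\<close>.
  Its blocks are the Sylvester--Hadamard matrices, since \<open>div 2\<close> and the parity split off a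
  tensor factor.\<close>

fun had :: "nat \<Rightarrow> nat \<Rightarrow> real" where
  "had a b = (if a < 2 \<or> b < 2 then of_bool (a = b)
     else had (a div 2) (b div 2) * (if odd a \<and> odd b then - 1 else 1) / sqrt 2)"

declare had.simps [simp del]

lemma had_small: "a < 2 \<Longrightarrow> had a b = of_bool (a = b)" "b < 2 \<Longrightarrow> had a b = of_bool (a = b)"
  by (simp_all add: had.simps)

lemma had_commute: "had a b = had b a"
  by (induction a b rule: had.induct) (subst (1 2) had.simps, auto)

text \<open>Halving both indices lowers \<open>m\<close> by one and ends in the diagonal base
  clause. With \<open>had_commute\<close> this gives rows and columns of finite support, so products
  with \<open>had\<close> are finite sums.\<close>

lemma had_eq_0:
  assumes "a < 2 ^ m" "2 ^ m \<le> b"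
  shows "had a b = 0"
  using assms
proof (induction m arbitrary: a b)
  case (Suc m)
  show ?case
  proof (cases "a < 2")
    case True
    have "2 \<le> b" using Suc.prems(2) by (metis dual_order.trans one_le_power power_Suc mult_le_mono2 nat_mult_1_right one_le_numeral)
    then show ?thesis using True by (simp add: had_small)
  next
    case False
    have "a div 2 < 2 ^ m" "2 ^ m \<le> b div 2" using Suc.prems by auto
    then have "had (a div 2) (b div 2) = 0" by (rule Suc.IH)
    then show ?thesis using False Suc.prems by (subst had.simps) auto
  qed
qed (simp add: had_small)

text \<open>Splits the column index into its half and its parity. For \<open>c = 0\<close> the
  columns 0 and 1 belong to the base clause, where both sides vanish because
  \<open>2 \<le> a\<close>.\<close>

lemma had_double:
  assumes "2 \<le> a"
  shows "had a (2 * c) = had (a div 2) c / sqrt 2"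
    and "had a (2 * c + 1) = had (a div 2) c * (if odd a then - 1 else 1) / sqrt 2"
  using assms by (subst had.simps, cases c; auto simp: had_small)+

lemma sum_lessThan_double: "(\<Sum>c<2 * n. f c) = (\<Sum>c<n. f (2 * c) + f (2 * c + 1))"
  for f :: "nat \<Rightarrow> 'a::comm_monoid_add"
  by (induction n) (auto simp: add.assoc)

text \<open>Columns \<open>2 * c\<close> and \<open>2 * c + 1\<close> are summed in pairs. For
  indices from 2 on this factors the sum into the orthogonality relation for the halved indices and
  that of the 2 by 2 Hadamard matrix.\<close>

lemma had_orthogonal:
  assumes "a < 2 ^ m" "b < 2 ^ m"
  shows "(\<Sum>c<2 ^ m. had a c * had c b) = of_bool (a = b)"
  using assms
proof (induction m arbitrary: a b)
  case (Suc m)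
  consider "a < 2" | "b < 2" | "2 \<le> a" "2 \<le> b" by linarith
  then show ?case
  proof cases
    case 1
    then have "(\<Sum>c<2 ^ Suc m. had a c * had c b) = (\<Sum>c<2 ^ Suc m. if c = a then had a b else 0)"
      by (intro sum.cong) (auto simp: had_small)
    then show ?thesis using 1 Suc.prems by (simp add: had_small)
  next
    case 2
    then have "(\<Sum>c<2 ^ Suc m. had a c * had c b) = (\<Sum>c<2 ^ Suc m. if c = b then had a b else 0)"
      by (intro sum.cong) (auto simp: had_small)
    then show ?thesis using 2 Suc.prems by (simp add: had_small)
  next
    case 3
    define s where "s a = (if odd a then - 1 else 1 :: real)" for a :: nat
    have "(\<Sum>c<2 ^ Suc m. had a c * had c b) =
        (\<Sum>c<2 ^ m. had a (2 * c) * had (2 * c) b + had a (2 * c + 1) * had (2 * c + 1) b)"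
      unfolding power_Suc by (rule sum_lessThan_double)
    \<comment> \<open>The factor \<open>(1 + s a * s b) / 2\<close> is 1 for equal parities and 0
      otherwise.\<close>
    also have "\<dots> = (\<Sum>c<2 ^ m. had (a div 2) c * had c (b div 2) * ((1 + s a * s b) / 2))"
    proof (intro sum.cong refl)
      fix c
      have "had (2 * c) b = had c (b div 2) / sqrt 2"
        "had (2 * c + 1) b = had c (b div 2) * s b / sqrt 2"
        using had_double[OF 3(2), of c] by (simp_all only: s_def had_commute[of _ b] had_commute[of c])
      then show "had a (2 * c) * had (2 * c) b + had a (2 * c + 1) * had (2 * c + 1) b =
          had (a div 2) c * had c (b div 2) * ((1 + s a * s b) / 2)"
        by (simp only: had_double[OF 3(1)] flip: s_def) (simp add: field_simps)
    qed
    also have "\<dots> = of_bool (a div 2 = b div 2) * ((1 + s a * s b) / 2)"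
      using Suc.prems by (subst sum_distrib_right[symmetric], subst Suc.IH) auto
    also have "\<dots> = of_bool (a = b)"
    proof (cases "a div 2 = b div 2 \<and> (odd a \<longleftrightarrow> odd b)")
      case True
      then have "a = b" by (metis div_mult_mod_eq odd_iff_mod_2_eq_one even_iff_mod_2_eq_zero)
      then show ?thesis by (simp add: s_def)
    qed (auto simp: s_def)
    finally show ?thesis .
  qed
qed (simp add: had_small)

text \<open>Flatness of the blocks: every halving contributes a factor \<open>1 / sqrt 2\<close> up
  to sign, and \<open>k\<close> of them lead to the block of index 1, whose entry is 1. The lower
  bound on the eigenvalues rests on this.\<close>

lemma abs_had:
  assumes "2 ^ k \<le> a" "a < 2 ^ Suc k" "2 ^ k \<le> b" "b < 2 ^ Suc k"
  shows "\<bar>had a b\<bar> = 1 / sqrt (2 ^ k)"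
  using assms
proof (induction k arbitrary: a b)
  case (Suc k)
  have "(2::nat) \<le> 2 ^ Suc k" using one_le_power[of "2::nat" k] by simp
  then have "\<not> (a < 2 \<or> b < 2)" using Suc.prems by linarith
  moreover have "\<bar>had (a div 2) (b div 2)\<bar> = 1 / sqrt (2 ^ k)"
    using Suc.prems by (intro Suc.IH) auto
  ultimately show ?case by (subst had.simps) (auto simp: abs_mult real_sqrt_mult)
qed (simp add: had_small)

section \<open>The block Hadamard matrix as an operator on sequences\<close>

definition had_op :: "(nat \<Rightarrow> complex) \<Rightarrow> nat \<Rightarrow> complex" where
  "had_op = mat_app (\<lambda>a b. of_real (had a b))"

text \<open>Any power of two beyond the row index may serve as cut-off, as the indices below it form
  whole blocks. Sums for different rows can thus share one range.\<close>

lemma had_op_eq: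
  assumes "a < 2 ^ m"
  shows "had_op u a = (\<Sum>b<2 ^ m. of_real (had a b) * u b)"
  unfolding had_op_def mat_app_def
  using assms by (intro suminf_finite) (auto simp: had_eq_0)

lemma had_op_add: "had_op (u + v) = had_op u + had_op v"
  and had_op_scale: "had_op (\<lambda>n. c * u n) = (\<lambda>n. c * had_op u n)"
proof -
  have "had_op (u + v) a = (had_op u + had_op v) a" "had_op (\<lambda>n. c * u n) a = c * had_op u a" for a
    using had_op_eq[OF less_exp[of a]] by (simp_all add: algebra_simps sum.distrib sum_distrib_left)
  then show "had_op (u + v) = had_op u + had_op v" "had_op (\<lambda>n. c * u n) = (\<lambda>n. c * had_op u n)"
    by auto
qed

text \<open>A real symmetric orthogonal matrix squares to the identity. Rows are finite, so this
  holds for all sequences, summable or not.\<close>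

lemma had_op_involution: "had_op (had_op u) = u"
proof
  fix a
  let ?N = "{..<2 ^ a} :: nat set"
  have a: "a < 2 ^ a" by (rule less_exp)
  have "had_op (had_op u) a = (\<Sum>b\<in>?N. of_real (had a b) * (\<Sum>c\<in>?N. of_real (had b c) * u c))"
    using had_op_eq[where m = a] a by simp
  also have "\<dots> = (\<Sum>b\<in>?N. \<Sum>c\<in>?N. of_real (had a b * had b c) * u c)"
    by (simp add: sum_distrib_left mult.assoc)
  also have "\<dots> = (\<Sum>c\<in>?N. \<Sum>b\<in>?N. of_real (had a b * had b c) * u c)"
    by (rule sum.swap)
  also have "\<dots> = (\<Sum>c\<in>?N. of_real (\<Sum>b\<in>?N. had a b * had b c) * u c)"
    by (simp add: sum_distrib_right)
  also have "\<dots> = (\<Sum>c\<in>?N. if c = a then u c else 0)"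
    using a had_orthogonal[of a a] by (intro sum.cong) auto
  finally show "had_op (had_op u) a = u a" using a by simp
qed

lemma had_op_selfadjoint_fin:
  "(\<Sum>a<2 ^ m. had_op u a * cnj (v a)) = (\<Sum>a<2 ^ m. u a * cnj (had_op v a))"
proof -
  let ?N = "{..<2 ^ m} :: nat set"
  have "(\<Sum>a\<in>?N. had_op u a * cnj (v a)) = (\<Sum>a\<in>?N. \<Sum>b\<in>?N. of_real (had a b) * u b * cnj (v a))"
    using had_op_eq[of _ m u] by (simp add: sum_distrib_right)
  also have "\<dots> = (\<Sum>b\<in>?N. \<Sum>a\<in>?N. of_real (had b a) * u b * cnj (v a))"
    by (subst sum.swap) (simp add: had_commute)
  also have "\<dots> = (\<Sum>b\<in>?N. u b * cnj (had_op v b))"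
    using had_op_eq[of _ m v] by (simp add: sum_distrib_left ac_simps)
  finally show ?thesis .
qed

text \<open>With \<open>v = had_op u\<close>, the truncated selfadjointness and the involution
  property show that \<open>had_op\<close> preserves the sum of squares below every power of two
  exactly.\<close>

lemma had_op_l2:
  assumes "u \<in> l2"
  shows "had_op u \<in> l2"
proof (rule l2_boundI)
  fix N :: nat
  have "complex_of_real (\<Sum>a<2 ^ N. (cmod (had_op u a))\<^sup>2) = of_real (\<Sum>a<2 ^ N. (cmod (u a))\<^sup>2)"
    using had_op_selfadjoint_fin[of u "had_op u" N] unfolding of_real_sum complex_norm_square had_op_involution .
  then have eq: "(\<Sum>a<2 ^ N. (cmod (had_op u a))\<^sup>2) = (\<Sum>a<2 ^ N. (cmod (u a))\<^sup>2)"
    using of_real_eq_iff by blast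
  have "L2_set (\<lambda>n. cmod (had_op u n)) {..<N} \<le> L2_set (\<lambda>n. cmod (had_op u n)) {..<2 ^ N}"
    unfolding L2_set_def using less_exp[of N] by (intro real_sqrt_le_mono sum_mono2) auto
  also have "\<dots> = L2_set (\<lambda>n. cmod (u n)) {..<2 ^ N}"
    by (simp add: L2_set_def eq)
  also have "\<dots> \<le> l2_norm u"
    using assms by (intro L2_set_le_l2_norm) auto
  finally show "L2_set (\<lambda>n. cmod (had_op u n)) {..<N} \<le> l2_norm u" .
qed

lemma had_op_selfadjoint:
  assumes "u \<in> l2" "v \<in> l2"
  shows "ip ell2 (had_op u) v = ip ell2 u (had_op v)"
proof -
  \<comment> \<open>The identity \<open>had_op_selfadjoint_fin\<close> speaks of cut-offs
    \<open>2 ^ m\<close>, hence the passage to this subsequence of partial sums.\<close>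
  have "strict_mono (\<lambda>m::nat. 2 ^ m :: nat)" by (rule strict_monoI_Suc) simp
  then have *: "(\<lambda>m. \<Sum>a<2 ^ m. f a) \<longlonglongrightarrow> suminf f" if "summable f" for f :: "nat \<Rightarrow> complex"
    using LIMSEQ_subseq_LIMSEQ[OF summable_LIMSEQ[OF that]] by (simp add: comp_def)
  have "(\<lambda>m. \<Sum>a<2 ^ m. had_op u a * cnj (v a)) \<longlonglongrightarrow> ip ell2 (had_op u) v"
    using assms by (simp add: had_op_l2) (intro * summable_ip had_op_l2)
  moreover have "(\<lambda>m. \<Sum>a<2 ^ m. had_op u a * cnj (v a)) \<longlonglongrightarrow> ip ell2 u (had_op v)"
    unfolding had_op_selfadjoint_fin using assms by (simp add: had_op_l2) (intro * summable_ip had_op_l2)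
  ultimately show ?thesis by (rule LIMSEQ_unique)
qed

section \<open>Diagonal operators and their spectral measures\<close>

lemma l2_norm_sq: "u \<in> l2 \<Longrightarrow> (l2_norm u)\<^sup>2 = Re (ip ell2 u u)"
proof -
  assume u: "u \<in> l2"
  then have "0 \<le> (\<Sum>n. (cmod (u n))\<^sup>2)" by (intro suminf_nonneg) (auto simp: l2_def)
  then show ?thesis using Re_ip_self[OF u] u by (simp add: l2_norm_def)
qed

text \<open>Supplies the uniqueness required by the definite description in
  \<open>spectral_integral\<close>.\<close>

lemma ip_ext:
  assumes "w \<in> l2" "w' \<in> l2" "\<And>v. v \<in> l2 \<Longrightarrow> ip ell2 w v = ip ell2 w' v"
  shows "w = w'"
proof -
  interpret hilbert_space ell2 by (rule hilbert_ell2)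
  have d: "w - w' \<in> l2" using assms l2_diff by blast
  have "ip ell2 (w - w') (w - w') + ip ell2 w' (w - w') = ip ell2 w (w - w')"
    using ip_add[of "w - w'" w' "w - w'"] assms d by (simp del: ell2_sel(3))
  then have "ip ell2 (w - w') (w - w') = 0" using assms d by (simp del: ell2_sel(3))
  then have "l2_norm (w - w') = 0" using l2_norm_sq[OF d] by simp
  then show ?thesis using l2_norm_eq_0[OF d] by simp
qed

text \<open>The scalar form of the four-term combination in \<open>spectral_form\<close>; it will be
  applied to each coordinate.\<close>

lemma polarization:
  "(\<Sum>k<4. \<i> ^ k * of_real ((cmod (x + \<i> ^ k * y))\<^sup>2)) = 4 * (x * cnj y)"
proof -
  have "\<i> ^ 3 = - \<i>" by (simp add: power3_eq_cube)
  then show ?thesis unfolding complex_norm_square by (simp add: lessThan_nat_numeral algebra_simps)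
qed

text \<open>Conjugating by \<open>V\<close> moves the standard basis to another orthonormal basis.\<close>

locale l2_involution =
  fixes V :: "(nat \<Rightarrow> complex) \<Rightarrow> nat \<Rightarrow> complex"
  assumes V_l2: "u \<in> l2 \<Longrightarrow> V u \<in> l2"
    and V_add: "V (u + v) = V u + V v"
    and V_scale: "V (\<lambda>n. c * u n) = (\<lambda>n. c * V u n)"
    and V_V: "V (V u) = u"
    and V_ip: "u \<in> l2 \<Longrightarrow> v \<in> l2 \<Longrightarrow> ip ell2 (V u) v = ip ell2 u (V v)"
begin

definition diag_op :: "(nat \<Rightarrow> complex) \<Rightarrow> (nat \<Rightarrow> complex) \<Rightarrow> nat \<Rightarrow> complex" where
  "diag_op \<phi> u = V (\<lambda>n. \<phi> n * V u n)"

text \<open>The measure is concentrated on the natural numbers: the point \<open>real n\<close>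
  carries the projection onto the \<open>n\<close>-th vector of the basis transported by
  \<open>V\<close>.\<close>

definition spec :: "real set \<Rightarrow> (nat \<Rightarrow> complex) \<Rightarrow> nat \<Rightarrow> complex" where
  "spec S = diag_op (\<lambda>n. indicator S (real n))"

lemma V_norm: "u \<in> l2 \<Longrightarrow> l2_norm (V u) = l2_norm u"
proof -
  assume u: "u \<in> l2"
  have "(l2_norm (V u))\<^sup>2 = (l2_norm u)\<^sup>2"
    using u V_l2[OF u] V_ip[of u "V u"] by (simp only: l2_norm_sq V_V)
  then show ?thesis using u V_l2[OF u] by (simp add: l2_norm_nonneg)
qed

lemma diag_op_l2:
  assumes "u \<in> l2" "\<And>n. cmod (\<phi> n) \<le> C"
  shows "diag_op \<phi> u \<in> l2"
  unfolding diag_op_def by (rule V_l2, rule l2_bounded_mult(1)[OF V_l2]) (rule assms)+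

lemma diag_op_norm:
  assumes "u \<in> l2" "\<And>n. cmod (\<phi> n) \<le> C"
  shows "l2_norm (diag_op \<phi> u) \<le> C * l2_norm u"
proof -
  have "(\<lambda>n. \<phi> n * V u n) \<in> l2" "l2_norm (\<lambda>n. \<phi> n * V u n) \<le> C * l2_norm (V u)"
    by (rule l2_bounded_mult[OF V_l2], rule assms, rule assms)+
  then show ?thesis unfolding diag_op_def by (simp only: V_norm assms)
qed

lemma bounded_diag_op:
  assumes "\<And>n. cmod (\<phi> n) \<le> C"
  shows "bounded_op ell2 (diag_op \<phi>)"
proof -
  have "V (\<lambda>n. \<phi> n * (V u + V v) n) = V (\<lambda>n. \<phi> n * V u n) + V (\<lambda>n. \<phi> n * V v n)" for u v
    unfolding V_add[symmetric, of "\<lambda>n. \<phi> n * V u n"] by (simp add: plus_fun_def distrib_left)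
  then have "diag_op \<phi> (u + v) = diag_op \<phi> u + diag_op \<phi> v" for u v
    by (simp only: diag_op_def V_add)
  moreover have "V (\<lambda>n. \<phi> n * (c * V u n)) = (\<lambda>n. c * V (\<lambda>n. \<phi> n * V u n) n)" for c u
    unfolding V_scale[symmetric, of _ "\<lambda>n. \<phi> n * V u n"] by (simp add: mult.left_commute)
  then have "diag_op \<phi> (\<lambda>n. c * u n) = (\<lambda>n. c * diag_op \<phi> u n)" for c u
    by (simp only: diag_op_def V_scale)
  moreover have "diag_op \<phi> u \<in> l2" "l2_norm (diag_op \<phi> u) \<le> C * l2_norm u" if "u \<in> l2" for u
    using that assms by (rule diag_op_l2 diag_op_norm)+
  ultimately show ?thesis unfolding bounded_op_def ell2_sel by (metis hnorm_ell2)
qed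

lemma diag_op_diag_op: "diag_op \<phi> (diag_op \<psi> u) = diag_op (\<lambda>n. \<phi> n * \<psi> n) u"
  by (simp add: diag_op_def V_V mult.assoc)

lemma diag_op_diff: "diag_op \<phi> u - diag_op \<psi> u = diag_op (\<lambda>n. \<phi> n - \<psi> n) u"
proof -
  have "diag_op (\<lambda>n. \<phi> n - \<psi> n) u + diag_op \<psi> u = diag_op \<phi> u"
    unfolding diag_op_def V_add[symmetric] by (simp add: plus_fun_def algebra_simps)
  then show ?thesis by (metis add_diff_cancel_right')
qed

lemma V_0: "V 0 = 0"
  using V_add[of 0 0] by simp

lemma diag_op_sum: "(\<Sum>i\<in>I. diag_op (\<phi> i) u) = diag_op (\<lambda>n. \<Sum>i\<in>I. \<phi> i n) u"
proof (induction I rule: infinite_finite_induct)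
  case (insert i I)
  then show ?case
    unfolding diag_op_def by (simp add: V_add[symmetric]) (simp add: plus_fun_def distrib_right)
qed (use V_0 in \<open>simp_all add: diag_op_def zero_fun_def\<close>)

lemma ip_diag_op:
  assumes "u \<in> l2" "v \<in> l2" "\<And>n. cmod (\<phi> n) \<le> C"
  shows "ip ell2 (diag_op \<phi> u) v = (\<Sum>n. \<phi> n * (V u n * cnj (V v n)))"
  using assms V_ip[of "\<lambda>n. \<phi> n * V u n" v] l2_bounded_mult[OF V_l2, of u \<phi> C]
  by (simp add: diag_op_def V_l2 mult.assoc)

lemma orth_projection_spec: "orth_projection ell2 (spec S)"
proof -
  have ind: "cmod (indicator S (real n)) \<le> 1" for n by (simp add: indicator_def)
  have "ip ell2 (spec S u) v = ip ell2 u (spec S v)" if uv: "u \<in> l2" "v \<in> l2" for u v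
  proof -
    interpret hilbert_space ell2 by (rule hilbert_ell2)
    have l2: "(\<lambda>n. indicator S (real n) * V w n) \<in> l2" if "w \<in> l2" for w
      using that ind by (intro l2_bounded_mult V_l2)
    have "ip ell2 (spec S u) v = ip ell2 (\<lambda>n. indicator S (real n) * V u n) (V v)"
      unfolding spec_def diag_op_def by (intro V_ip l2 uv)
    also have "\<dots> = ip ell2 (V u) (\<lambda>n. indicator S (real n) * V v n)"
      using uv by (simp add: l2 V_l2) (intro suminf_cong, simp add: indicator_def)
    also have "\<dots> = ip ell2 u (spec S v)"
      unfolding spec_def diag_op_def by (intro V_ip l2 uv)
    finally show ?thesis .
  qed
  moreover have "spec S (spec S u) = spec S u" for u
    unfolding spec_def diag_op_diag_op by (intro arg_cong2[of _ _ _ _ diag_op]) (auto simp: indicator_def)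
  ultimately show ?thesis
    using bounded_diag_op[OF ind] unfolding orth_projection_def by (simp add: spec_def)
qed

text \<open>The difference between the partial sum and the projection of the union is diagonal, so
  strong convergence is dominated convergence for the coordinates \<open>V u k\<close>. The
  multipliers \<open>d n k\<close> tend to 0 for each \<open>k\<close> and never exceed 1 in
  modulus.\<close>

lemma spectral_measure_spec: "spectral_measure ell2 spec"
  unfolding spectral_measure_def
proof (intro conjI ballI allI impI)
  show "spec UNIV u = u" for u by (simp add: spec_def diag_op_def V_V)
next
  fix A :: "nat \<Rightarrow> real set" and u
  assume dis: "disjoint_family A" and "u \<in> vecs ell2"
  then have u: "u \<in> l2" by simp
  define d where "d n k = (indicator (\<Union>i<n. A i) (real k) - indicator (\<Union>i. A i) (real k) :: complex)" for n k
  have d1: "cmod (d n k) \<le> 1" for n k by (auto simp: d_def indicator_def)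
  have "(\<lambda>n. d n k) \<longlonglongrightarrow> 0" for k
  proof (cases "real k \<in> (\<Union>i. A i)")
    case True
    then obtain i where "real k \<in> A i" by blast
    then have "d n k = 0" if "n > i" for n using that by (auto simp: d_def indicator_def)
    then show ?thesis
      by (intro tendsto_eventually eventually_mono[OF eventually_gt_at_top[of i]]) auto
  qed (auto simp: d_def)
  then have "(\<lambda>n. (cmod (d n k * V u k))\<^sup>2) \<longlonglongrightarrow> (cmod (0 * V u k))\<^sup>2" for k
    by (intro tendsto_intros)
  then have "(\<lambda>n. \<Sum>k. (cmod (d n k * V u k))\<^sup>2) \<longlonglongrightarrow> (\<Sum>k. 0)"
  proof (intro tannerys_theorem[where M = "\<lambda>k. (cmod (V u k))\<^sup>2", THEN conjunct2, THEN conjunct2])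
    have "(cmod (d n k * V u k))\<^sup>2 \<le> (cmod (V u k))\<^sup>2" for n k
      unfolding norm_mult using d1[of n k] by (intro power_mono mult_left_le_one_le) auto
    then show "\<forall>\<^sub>F (k, n) in at_top \<times>\<^sub>F at_top. norm ((cmod (d n k * V u k))\<^sup>2) \<le> (cmod (V u k))\<^sup>2"
      by (intro always_eventually) auto
    show "summable (\<lambda>k. (cmod (V u k))\<^sup>2)" using V_l2[OF u] by (simp add: l2_def)
  qed auto
  then have "(\<lambda>n. sqrt (\<Sum>k. (cmod (d n k * V u k))\<^sup>2)) \<longlonglongrightarrow> sqrt 0"
    by (intro tendsto_intros) simp
  moreover have "hnorm ell2 ((\<Sum>i<n. spec (A i) u) - spec (\<Union>i. A i) u) = sqrt (\<Sum>k. (cmod (d n k * V u k))\<^sup>2)" for n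
  proof -
    have "(\<Sum>i<n. indicator (A i) (real k)) = (indicator (\<Union>i<n. A i) (real k) :: complex)" for k
      using dis by (intro indicator_UN_disjoint[symmetric]) (auto simp: disjoint_family_on_def)
    then have "(\<Sum>i<n. spec (A i) u) - spec (\<Union>i. A i) u = diag_op (d n) u"
      unfolding spec_def diag_op_sum diag_op_diff d_def by simp
    then show ?thesis
      using l2_bounded_mult(1)[OF V_l2[OF u] d1[of n]] u diag_op_l2[OF u d1[of n]]
      by (simp add: diag_op_def V_norm) (simp add: l2_norm_def)
  qed
  ultimately show "(\<lambda>n. hnorm ell2 ((\<Sum>i<n. spec (A i) u) - spec (\<Union>i. A i) u)) \<longlonglongrightarrow> 0"
    by simp
qed (rule orth_projection_spec)

section \<open>Integrals with respect to a diagonal spectral measure\<close>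

lemma spectral_distr_spec:
  assumes u: "u \<in> l2"
  shows "spectral_distr ell2 spec u =
    distr (density (count_space UNIV) (\<lambda>n. ennreal ((cmod (V u n))\<^sup>2))) borel real" (is "_ = ?M")
proof -
  \<comment> \<open>The scalar measure of \<open>u\<close> has the squared modulus of
    \<open>V u n\<close> as mass at the point \<open>real n\<close>. As \<open>measure_of\<close>
    depends only on the values on Borel sets, comparison with the genuine measure \<open>?M\<close>
    suffices.\<close>
  have "measure_of UNIV (sets borel) (\<lambda>S. ennreal (Re (ip ell2 (spec S u) u))) =
      measure_of UNIV (sets borel) (emeasure ?M)"
  proof (rule measure_of_eq)
    fix S :: "real set" assume "S \<in> sigma_sets UNIV (sets borel)"
    then have S: "S \<in> sets borel" using sets.sigma_sets_eq[of "borel :: real measure"] by simp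
    have sm: "summable (\<lambda>n. indicator S (real n) * (cmod (V u n))\<^sup>2)"
      by (rule summable_comparison_test[where g = "\<lambda>n. (cmod (V u n))\<^sup>2"])
        (use V_l2[OF u] in \<open>auto simp: l2_def indicator_def\<close>)
    have "ip ell2 (spec S u) u = (\<Sum>n. indicator S (real n) * (V u n * cnj (V u n)))"
      unfolding spec_def by (intro ip_diag_op[where C = 1] u) (simp add: indicator_def)
    also have "\<dots> = (\<Sum>n. complex_of_real (indicator S (real n) * (cmod (V u n))\<^sup>2))"
      by (intro suminf_cong) (auto simp: indicator_def simp flip: complex_norm_square)
    also have "\<dots> = of_real (\<Sum>n. indicator S (real n) * (cmod (V u n))\<^sup>2)"
      using sm by (rule suminf_of_real[symmetric])
    finally have ip: "Re (ip ell2 (spec S u) u) = (\<Sum>n. indicator S (real n) * (cmod (V u n))\<^sup>2)"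
      by simp
    have "emeasure ?M S = (\<Sum>n. ennreal (indicator S (real n) * (cmod (V u n))\<^sup>2))"
      using S by (simp add: emeasure_distr emeasure_density nn_integral_count_space_nat)
        (intro suminf_cong, auto simp: indicator_def)
    also have "\<dots> = ennreal (Re (ip ell2 (spec S u) u))"
      unfolding ip using sm by (intro suminf_ennreal2) auto
    finally show "ennreal (Re (ip ell2 (spec S u) u)) = emeasure ?M S" by simp
  qed simp
  also have "\<dots> = ?M" using measure_of_of_measure[of ?M] by simp
  finally show ?thesis unfolding spectral_distr_def .
qed

lemma summable_weighted:
  assumes "u \<in> l2" "\<And>n. cmod (\<phi> n) \<le> C"
  shows "summable (\<lambda>n. cmod ((cmod (V u n))\<^sup>2 *\<^sub>R \<phi> n))"
  by (rule summable_comparison_test[OF _ summable_mult2[of "\<lambda>n. (cmod (V u n))\<^sup>2" C]])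
    (use V_l2[OF assms(1)] assms(2) in \<open>auto simp: l2_def intro!: mult_left_mono\<close>)

lemma integral_spectral_distr:
  assumes "u \<in> l2" "\<phi> \<in> borel_measurable borel" "\<And>x. cmod (\<phi> x) \<le> C"
  shows "(LINT x|spectral_distr ell2 spec u. \<phi> x) = (\<Sum>n. (cmod (V u n))\<^sup>2 *\<^sub>R \<phi> (real n))"
proof -
  have "(LINT x|spectral_distr ell2 spec u. \<phi> x) =
      (LINT n|density (count_space UNIV) (\<lambda>n. ennreal ((cmod (V u n))\<^sup>2)). \<phi> (real n))"
    unfolding spectral_distr_spec[OF assms(1)] using assms(2) by (intro integral_distr) simp_all
  also have "\<dots> = (LINT n|count_space UNIV. (cmod (V u n))\<^sup>2 *\<^sub>R \<phi> (real n))"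
    by (intro integral_density) simp_all
  also have "\<dots> = (\<Sum>n. (cmod (V u n))\<^sup>2 *\<^sub>R \<phi> (real n))"
    by (rule integral_count_space_nat, unfold integrable_count_space_nat_iff)
      (rule summable_weighted[OF assms(1,3)])
  finally show ?thesis .
qed

text \<open>\<open>V\<close> is linear, so the four series arising from the definition can be merged
  and \<open>polarization\<close> applied to each coordinate.\<close>

lemma spectral_form_spec:
  assumes uv: "u \<in> l2" "v \<in> l2" and \<phi>: "\<phi> \<in> borel_measurable borel" "\<And>x. cmod (\<phi> x) \<le> C"
  shows "spectral_form ell2 spec \<phi> u v = ip ell2 (diag_op (\<lambda>n. \<phi> (real n)) u) v"
proof -
  let ?w = "\<lambda>k. u + (\<lambda>n. \<i> ^ k * v n)"
  have w: "?w k \<in> l2" for k by (intro l2_add l2_scale uv)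
  have Vw: "V (?w k) n = V u n + \<i> ^ k * V v n" for k n by (simp add: V_add V_scale)
  have sm: "summable (\<lambda>n. (cmod (V (?w k) n))\<^sup>2 *\<^sub>R \<phi> (real n))" for k
    by (rule summable_norm_cancel, rule summable_weighted[OF w \<phi>(2)])
  have "spectral_form ell2 spec \<phi> u v = (1 / 4) * (\<Sum>k<4. \<i> ^ k * (\<Sum>n. (cmod (V (?w k) n))\<^sup>2 *\<^sub>R \<phi> (real n)))"
    unfolding spectral_form_def ell2_sel by (simp only: integral_spectral_distr[OF w \<phi>])
  also have "\<dots> = (1 / 4) * (\<Sum>n. \<Sum>k<4. \<i> ^ k * ((cmod (V (?w k) n))\<^sup>2 *\<^sub>R \<phi> (real n)))"
    using sm by (simp only: suminf_sum summable_mult suminf_mult)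
  also have "\<dots> = (\<Sum>n. (1 / 4) * (\<Sum>k<4. \<i> ^ k * ((cmod (V (?w k) n))\<^sup>2 *\<^sub>R \<phi> (real n))))"
    using sm by (intro suminf_mult[symmetric] summable_sum summable_mult)
  also have "\<dots> = (\<Sum>n. \<phi> (real n) * (V u n * cnj (V v n)))"
  proof (rule suminf_cong)
    fix n
    have "(\<Sum>k<4. \<i> ^ k * ((cmod (V (?w k) n))\<^sup>2 *\<^sub>R \<phi> (real n))) =
        (\<Sum>k<4. \<i> ^ k * of_real ((cmod (V u n + \<i> ^ k * V v n))\<^sup>2)) * \<phi> (real n)"
      unfolding Vw sum_distrib_right by (simp add: scaleR_conv_of_real mult.assoc)
    then show "(1 / 4) * (\<Sum>k<4. \<i> ^ k * ((cmod (V (?w k) n))\<^sup>2 *\<^sub>R \<phi> (real n))) =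
        \<phi> (real n) * (V u n * cnj (V v n))"
      unfolding polarization by simp
  qed
  also have "\<dots> = ip ell2 (diag_op (\<lambda>n. \<phi> (real n)) u) v"
    using uv \<phi>(2) by (intro ip_diag_op[symmetric])
  finally show ?thesis .
qed

text \<open>The diagonal operator has the required form values, and \<open>ip_ext\<close> makes it
  the only candidate. The bound on \<open>\<phi>\<close> is pointwise, which masks and signs
  satisfy.\<close>

lemma spectral_integral_spec:
  assumes u: "u \<in> l2" and \<phi>: "\<phi> \<in> borel_measurable borel" "\<And>x. cmod (\<phi> x) \<le> C"
  shows "spectral_integral ell2 spec \<phi> u = diag_op (\<lambda>n. \<phi> (real n)) u"
proof -
  have l2: "diag_op (\<lambda>n. \<phi> (real n)) u \<in> l2" using u \<phi>(2) by (rule diag_op_l2)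
  show ?thesis
    unfolding spectral_integral_def
    using l2 by (intro the_equality) (auto simp: spectral_form_spec[OF u _ \<phi>] intro!: ip_ext simp del: ell2_sel(3))
qed

end

lemma l2_involution_id: "l2_involution (\<lambda>u. u)"
  by unfold_locales auto

lemma l2_involution_had: "l2_involution had_op"
  by (intro l2_involution.intro had_op_add had_op_scale had_op_involution had_op_l2 had_op_selfadjoint)

section \<open>Singular values\<close>

lemma l2_norm_scale: "u \<in> l2 \<Longrightarrow> l2_norm (\<lambda>n. c * u n) = cmod c * l2_norm u"
  by (simp add: l2_norm_def l2_def norm_mult power_mult_distrib suminf_mult real_sqrt_mult)

lemma bounded_opD:
  assumes "bounded_op ell2 T"
  shows "u \<in> l2 \<Longrightarrow> T u \<in> l2"
    and "u \<in> l2 \<Longrightarrow> v \<in> l2 \<Longrightarrow> T (u + v) = T u + T v"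
    and "u \<in> l2 \<Longrightarrow> T (\<lambda>n. c * u n) = (\<lambda>n. c * T u n)"
    and "T 0 = 0"
    and "\<exists>C. \<forall>u\<in>l2. l2_norm (T u) \<le> C * l2_norm u"
proof -
  show 1: "u \<in> l2 \<Longrightarrow> T u \<in> l2"
    and "u \<in> l2 \<Longrightarrow> v \<in> l2 \<Longrightarrow> T (u + v) = T u + T v"
    and 3: "\<And>u c. u \<in> l2 \<Longrightarrow> T (\<lambda>n. c * u n) = (\<lambda>n. c * T u n)" for u v
    using assms by (auto simp: bounded_op_def)
  show "T 0 = 0" using 3[of 0 0] l2_zero by (simp add: zero_fun_def)
  show "\<exists>C. \<forall>u\<in>l2. l2_norm (T u) \<le> C * l2_norm u"
    using assms 1 by (auto simp: bounded_op_def)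
qed

lemma bounded_op_diff:
  assumes T: "bounded_op ell2 T" and K: "bounded_op ell2 K"
  shows "bounded_op ell2 (\<lambda>u. T u - K u)"
proof -
  obtain C D where C: "\<And>u. u \<in> l2 \<Longrightarrow> l2_norm (T u) \<le> C * l2_norm u"
    and D: "\<And>u. u \<in> l2 \<Longrightarrow> l2_norm (K u) \<le> D * l2_norm u"
    using bounded_opD(5)[OF T] bounded_opD(5)[OF K] by blast
  have "l2_norm (T u - K u) \<le> (C + D) * l2_norm u" if "u \<in> l2" for u
    using l2_diff(2)[of "T u" "K u"] C[OF that] D[OF that] bounded_opD(1)[OF T that] bounded_opD(1)[OF K that]
    by (simp add: distrib_right)
  moreover have "T (u + v) - K (u + v) = (T u - K u) + (T v - K v)" if "u \<in> l2" "v \<in> l2" for u v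
    using that by (simp add: bounded_opD(2)[OF T] bounded_opD(2)[OF K] del: plus_fun_apply)
  moreover have "T (\<lambda>n. c * u n) - K (\<lambda>n. c * u n) = (\<lambda>n. c * (T u - K u) n)" if "u \<in> l2" for c u
    using that by (auto simp: bounded_opD(3)[OF T] bounded_opD(3)[OF K] right_diff_distrib)
  moreover have "T u - K u \<in> l2" if "u \<in> l2" for u
    using that by (intro l2_diff bounded_opD(1)[OF T] bounded_opD(1)[OF K])
  ultimately show ?thesis
    unfolding bounded_op_def ell2_sel by (metis hnorm_ell2)
qed

lemma bdd_above_op_norm:
  assumes "bounded_op ell2 T"
  shows "bdd_above {hnorm ell2 (T u) |u. u \<in> vecs ell2 \<and> hnorm ell2 u \<le> 1}"
proof -
  obtain C where C: "\<And>u. u \<in> l2 \<Longrightarrow> l2_norm (T u) \<le> C * l2_norm u"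
    using bounded_opD(5)[OF assms] by blast
  have "hnorm ell2 (T u) \<le> \<bar>C\<bar>" if "u \<in> l2" "l2_norm u \<le> 1" for u
  proof -
    have "C * l2_norm u \<le> \<bar>C\<bar> * 1"
      using that l2_norm_nonneg by (intro mult_mono) auto
    then show ?thesis using C[OF that(1)] that bounded_opD(1)[OF assms] by simp
  qed
  then show ?thesis by (intro bdd_aboveI[of _ "\<bar>C\<bar>"]) auto
qed

lemma op_norm_nonneg:
  assumes "bounded_op ell2 T"
  shows "0 \<le> op_norm ell2 T"
proof -
  have "hnorm ell2 (T 0) \<le> op_norm ell2 T"
    unfolding op_norm_def by (intro cSup_upper bdd_above_op_norm assms) (use l2_zero in auto)
  then show ?thesis by (simp add: bounded_opD[OF assms] l2_zero)
qed

lemma l2_norm_le_op_norm: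
  assumes T: "bounded_op ell2 T" and u: "u \<in> l2"
  shows "l2_norm (T u) \<le> op_norm ell2 T * l2_norm u"
proof (cases "u = 0")
  case False
  then have pos: "0 < l2_norm u" using l2_norm_eq_0[OF u] l2_norm_nonneg[OF u] by simp
  let ?c = "complex_of_real (1 / l2_norm u)"
  have "hnorm ell2 (T (\<lambda>n. ?c * u n)) \<le> op_norm ell2 T"
    unfolding op_norm_def
  proof (intro cSup_upper bdd_above_op_norm T CollectI exI[of _ "\<lambda>n. ?c * u n"] conjI)
    show "hnorm ell2 (T (\<lambda>n. ?c * u n)) = hnorm ell2 (T (\<lambda>n. ?c * u n))" by (rule refl)
    show "(\<lambda>n. ?c * u n) \<in> vecs ell2" using u by (simp add: l2_scale del: of_real_divide)
    show "hnorm ell2 (\<lambda>n. ?c * u n) \<le> 1"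
      using pos u by (simp add: l2_scale l2_norm_scale norm_divide del: of_real_divide)
  qed
  then have "cmod ?c * l2_norm (T u) \<le> op_norm ell2 T"
    using u by (simp add: bounded_opD[OF T] l2_scale l2_norm_scale del: of_real_divide)
  then have "l2_norm (T u) / l2_norm u \<le> op_norm ell2 T"
    using pos by (simp add: norm_divide)
  then show ?thesis using pos by (simp add: field_simps)
qed (use l2_zero bounded_opD(4)[OF T] in simp)

text \<open>There are more vectors than the dimension allows. The relation is stated for an indexed
  family, so a repeated vector is treated apart: its two indices get the coefficients 1 and
  -1.\<close>

lemma (in vector_space) nontrivial_relation:
  assumes "finite J" "finite B" "card B < card J" "f ` J \<subseteq> span B"
  shows "\<exists>c. (\<exists>j\<in>J. c j \<noteq> 0) \<and> (\<Sum>j\<in>J. scale (c j) (f j)) = 0"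
proof (cases "inj_on f J")
  case True
  then have "dependent (f ` J)"
    using independent_span_bound[OF \<open>finite B\<close>, of "f ` J"] assms by (auto simp: card_image)
  then obtain c where "\<exists>v\<in>f ` J. c v \<noteq> 0" "(\<Sum>v\<in>f ` J. scale (c v) v) = 0"
    using assms(1) by (auto simp: dependent_finite)
  then show ?thesis
    using True by (intro exI[of _ "c \<circ> f"]) (auto simp: sum.reindex)
next
  case False
  then obtain i j where ij: "i \<in> J" "j \<in> J" "f i = f j" "i \<noteq> j" by (auto simp: inj_on_def)
  let ?c = "\<lambda>k. if k = i then 1 else if k = j then - 1 else 0"
  have "(\<Sum>k\<in>J. scale (?c k) (f k)) = (\<Sum>k\<in>{i, j}. scale (?c k) (f k))"
    using assms ij by (intro sum.mono_neutral_right) auto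
  also have "\<dots> = 0" using ij by (auto simp: scale_minus_left)
  finally show ?thesis using ij(1) by (intro exI[of _ ?c]) auto
qed

lemma bounded_op_sum:
  assumes K: "bounded_op ell2 K" and f: "\<And>j. j \<in> J \<Longrightarrow> f j \<in> l2"
  shows "K (\<Sum>j\<in>J. (\<lambda>n. c j * f j n)) = (\<Sum>j\<in>J. (\<lambda>n. c j * K (f j) n))"
  using f
proof (induction J rule: infinite_finite_induct)
  case (insert i J)
  then have "(\<Sum>j\<in>J. (\<lambda>n. c j * f j n)) \<in> l2" by (intro l2_sum l2_scale) auto
  then have "K ((\<lambda>n. c i * f i n) + (\<Sum>j\<in>J. (\<lambda>n. c j * f j n))) =
      (\<lambda>n. c i * K (f i) n) + K (\<Sum>j\<in>J. (\<lambda>n. c j * f j n))"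
    using insert.prems by (simp only: bounded_opD(2,3)[OF K] l2_scale insertI1)
  then show ?case using insert by (simp del: plus_fun_apply)
qed (simp_all add: bounded_opD[OF K])

lemma bounded_op_diag:
  assumes "\<And>n. cmod (w n) \<le> C"
  shows "bounded_op ell2 (\<lambda>u n. w n * u n)"
proof -
  have "(\<lambda>n. w n * u n) \<in> l2" "l2_norm (\<lambda>n. w n * u n) \<le> C * l2_norm u" if "u \<in> l2" for u
    using that assms by (rule l2_bounded_mult)+
  then show ?thesis
    unfolding bounded_op_def by (auto simp: plus_fun_def distrib_left mult.left_commute)
qed

lemma bounded_op_zero: "bounded_op ell2 (\<lambda>u. 0)"
  using bounded_op_diag[of "\<lambda>_. 0" 0] by (simp add: zero_fun_def)

lemma rank_le_zero: "rank_le ell2 (\<lambda>u. 0) n"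
proof -
  interpret vector_space "scl ell2" using hilbert_ell2 by (rule hilbert_space.vector_space)
  show ?thesis unfolding rank_le_def by (intro exI[of _ "{}"]) (auto simp: span_empty)
qed

text \<open>An operator \<open>K\<close> of rank at most \<open>n\<close> annihilates some nonzero
  vector supported on \<open>J\<close>, which has more than \<open>n\<close> elements. On that
  vector the difference from \<open>K\<close> acts as the diagonal operator and stretches by at
  least \<open>\<delta>\<close>.\<close>

lemma singular_value_diag_ge:
  assumes w: "\<And>n. cmod (w n) \<le> C" and J: "finite J" "n < card J"
    and \<delta>: "0 \<le> \<delta>" "\<And>j. j \<in> J \<Longrightarrow> \<delta> \<le> cmod (w j)"
  shows "\<delta> \<le> singular_value ell2 (\<lambda>u n. w n * u n) n"
  unfolding singular_value_def
proof (rule cInf_greatest)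
  show "{op_norm ell2 (\<lambda>u. (\<lambda>n. w n * u n) - K u) |K. bounded_op ell2 K \<and> rank_le ell2 K n} \<noteq> {}"
    using bounded_op_zero rank_le_zero by blast
next
  let ?W = "\<lambda>u n. w n * u n"
  fix x assume "x \<in> {op_norm ell2 (\<lambda>u. ?W u - K u) |K. bounded_op ell2 K \<and> rank_le ell2 K n}"
  then obtain K where x: "x = op_norm ell2 (\<lambda>u. ?W u - K u)"
    and K: "bounded_op ell2 K" "rank_le ell2 K n" by blast
  obtain B where B: "finite B" "card B \<le> n" "K ` l2 \<subseteq> module.span (scl ell2) B"
    using K(2) by (auto simp: rank_le_def)
  define e :: "nat \<Rightarrow> nat \<Rightarrow> complex" where "e j n = of_bool (n = j)" for j n
  have e: "e j \<in> l2" for j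
    unfolding l2_def e_def by (auto intro: summable_finite[of "{j}"])
  interpret vector_space "scl ell2" using hilbert_ell2 by (rule hilbert_space.vector_space)
  have "(\<lambda>j. K (e j)) ` J \<subseteq> span B" using B(3) e by blast
  then obtain c where c: "\<exists>j\<in>J. c j \<noteq> 0" "(\<Sum>j\<in>J. scl ell2 (c j) (K (e j))) = 0"
    using nontrivial_relation[of J B "\<lambda>j. K (e j)"] B J by auto
  define u where "u = (\<Sum>j\<in>J. (\<lambda>n. c j * e j n))"
  have u_eq: "u n = (if n \<in> J then c n else 0)" for n
    using J by (simp add: u_def sum_fun_eval e_def of_bool_def if_distrib cong: if_cong)
  have u: "u \<in> l2" unfolding u_def by (intro l2_sum l2_scale e)
  have "u \<noteq> 0" using c(1) u_eq by (metis zero_fun_apply)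
  then have pos: "0 < l2_norm u" using l2_norm_eq_0[OF u] l2_norm_nonneg[OF u] by simp
  have Ku: "K u = 0" unfolding u_def bounded_op_sum[OF K(1) e] using c(2) by simp
  have bd: "bounded_op ell2 (\<lambda>u. ?W u - K u)"
    by (intro bounded_op_diff bounded_op_diag[OF w] K)
  have "\<delta> * l2_norm u = l2_norm (\<lambda>n. of_real \<delta> * u n)"
    using \<delta> u by (simp add: l2_norm_scale)
  also have "\<dots> \<le> 1 * l2_norm (?W u)"
    by (rule l2_dominated(2)[OF l2_bounded_mult(1)[OF u w]])
      (use \<delta> in \<open>auto simp: u_eq norm_mult mult_right_mono\<close>)
  also have "\<dots> \<le> x * l2_norm u"
    using l2_norm_le_op_norm[OF bd u] by (simp add: x Ku)
  finally show "\<delta> \<le> x" using pos by simp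
qed

lemma cmod_ip_le:
  assumes "u \<in> l2" "v \<in> l2"
  shows "cmod (ip ell2 u v) \<le> l2_norm u * l2_norm v"
proof -
  have "cmod (ip ell2 u v) \<le> (\<Sum>n. cmod (u n * cnj (v n)))"
    using assms summable_norm[OF summable_ip(2)] by simp
  also have "\<dots> \<le> l2_norm u * l2_norm v"
  proof (rule suminf_le_const[OF summable_ip(2)[OF assms]])
    fix n
    have "(\<Sum>i<n. cmod (u i * cnj (v i))) \<le> L2_set (\<lambda>n. cmod (u n)) {..<n} * L2_set (\<lambda>n. cmod (v n)) {..<n}"
      using L2_set_mult_ineq[of "\<lambda>n. cmod (u n)" "\<lambda>n. cmod (v n)" "{..<n}"] by (simp add: norm_mult)
    also have "\<dots> \<le> l2_norm u * l2_norm v"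
      using assms by (intro mult_mono L2_set_le_l2_norm l2_norm_nonneg L2_set_nonneg) auto
    finally show "(\<Sum>i<n. cmod (u i * cnj (v i))) \<le> l2_norm u * l2_norm v" .
  qed
  finally show ?thesis .
qed

section \<open>Rank one operators\<close>

definition rank_one :: "(nat \<Rightarrow> complex) \<Rightarrow> (nat \<Rightarrow> complex) \<Rightarrow> (nat \<Rightarrow> complex) \<Rightarrow> nat \<Rightarrow> complex" where
  "rank_one q g u = (\<lambda>n. ip ell2 u q * g n)"

lemma bounded_rank_one:
  assumes "q \<in> l2" "g \<in> l2"
  shows "bounded_op ell2 (rank_one q g)"
proof -
  interpret hilbert_space ell2 by (rule hilbert_ell2)
  have "l2_norm (rank_one q g u) \<le> l2_norm q * l2_norm g * l2_norm u" if "u \<in> l2" for u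
    using mult_right_mono[OF cmod_ip_le[OF that assms(1)] l2_norm_nonneg[OF assms(2)]] assms
    unfolding rank_one_def l2_norm_scale[OF assms(2)] by (simp add: mult_ac del: ell2_sel(3))
  moreover have "rank_one q g u \<in> l2" for u
    using assms by (simp add: rank_one_def l2_scale)
  moreover have "rank_one q g (u + v) = rank_one q g u + rank_one q g v" if "u \<in> l2" "v \<in> l2" for u v
    using ip_add[of u v q] that assms by (simp add: rank_one_def plus_fun_def distrib_right del: ell2_sel(3))
  moreover have "rank_one q g (\<lambda>n. c * u n) = (\<lambda>n. c * rank_one q g u n)" if "u \<in> l2" for c u
    using ip_scl[of u q c] that assms by (simp add: rank_one_def mult.assoc del: ell2_sel(3))
  ultimately show ?thesis unfolding bounded_op_def by auto
qed

text \<open>For \<open>n\<close> at least 1 the operator is its own approximant of rank at most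
  \<open>n\<close>, so only the term for \<open>n = 0\<close> of the Schatten series can be
  nonzero.\<close>

lemma rank_one_Schatten:
  assumes "q \<in> l2" "g \<in> l2" "0 < p"
  shows "rank_one q g \<in> Schatten ell2 p"
proof -
  let ?Q = "rank_one q g"
  have Q: "bounded_op ell2 ?Q" using assms by (intro bounded_rank_one)
  interpret vector_space "scl ell2" using hilbert_ell2 by (rule hilbert_space.vector_space)
  have "singular_value ell2 ?Q n = 0" if "n \<notin> {0}" for n
    unfolding singular_value_def
  proof (rule cInf_eq_minimum)
    have "?Q u \<in> span {g}" for u
      using span_scale[OF span_base[of g "{g}"], of "ip ell2 u q"] by (simp add: rank_one_def)
    then have "rank_le ell2 ?Q n"
      unfolding rank_le_def using that assms by (intro exI[of _ "{g}"]) auto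
    moreover have "op_norm ell2 (\<lambda>u. ?Q u - ?Q u) = 0"
    proof (rule antisym)
      show "op_norm ell2 (\<lambda>u. ?Q u - ?Q u) \<le> 0"
        unfolding op_norm_def by (rule cSup_least) (use l2_zero in auto)
    qed (intro op_norm_nonneg bounded_op_diff Q)
    ultimately show "0 \<in> {op_norm ell2 (\<lambda>u. ?Q u - K u) |K. bounded_op ell2 K \<and> rank_le ell2 K n}"
      using Q by force
  qed (use Q in \<open>auto intro!: op_norm_nonneg bounded_op_diff\<close>)
  then have "summable (\<lambda>n. singular_value ell2 ?Q n powr p)"
    using assms by (intro summable_finite[of "{0}"]) auto
  then show ?thesis using Q by (simp add: Schatten_def)
qed

section \<open>The counterexample\<close>

text \<open>A rectangular partial sum of a diagonal array is the ordinary partial sum up to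
  \<open>min M N\<close>, so the joint limit reduces to a single one.\<close>

lemma tendsto_diagonal_sums:
  fixes t :: "nat \<Rightarrow> 'a::real_normed_vector"
  assumes "t sums s"
  shows "((\<lambda>(M, N). \<Sum>j\<le>M. \<Sum>k\<le>N. if j = k then t j else 0) \<longlongrightarrow> s)
    (sequentially \<times>\<^sub>F sequentially)"
proof -
  have eq: "(\<Sum>j\<le>M. \<Sum>k\<le>N. if j = k then t j else 0) = (\<Sum>j\<le>min M N. t j)" for M N
  proof -
    have "(\<Sum>j\<le>M. \<Sum>k\<le>N. if j = k then t j else 0) = (\<Sum>j\<le>M. if j \<le> N then t j else 0)"
      by (intro sum.cong refl) (subst sum.delta'; simp)
    also have "\<dots> = (\<Sum>j\<in>{j \<in> {..M}. j \<le> N}. t j)" by (rule sum.inter_filter[symmetric]) simp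
    also have "{j \<in> {..M}. j \<le> N} = {..min M N}" by auto
    finally show ?thesis .
  qed
  show ?thesis
  proof (rule topological_tendstoI)
    fix S assume S: "open S" "s \<in> S"
    have "(\<lambda>n. \<Sum>j\<le>n. t j) \<longlonglongrightarrow> s" using assms by (simp add: sums_def_le)
    then have "\<forall>\<^sub>F n in sequentially. (\<Sum>j\<le>n. t j) \<in> S" using S by (rule topological_tendstoD)
    then obtain n0 where "\<And>n. n \<ge> n0 \<Longrightarrow> (\<Sum>j\<le>n. t j) \<in> S"
      unfolding eventually_sequentially by blast
    then show "\<forall>\<^sub>F x in sequentially \<times>\<^sub>F sequentially.
        (case x of (M, N) \<Rightarrow> \<Sum>j\<le>M. \<Sum>k\<le>N. if j = k then t j else 0) \<in> S"
      unfolding eventually_prod_sequentially by (intro exI[of _ n0]) (simp only: eq prod.case, simp)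
  qed
qed

lemma ip_sum_ell2:
  assumes "\<And>i. i \<in> I \<Longrightarrow> f i \<in> l2" "v \<in> l2"
  shows "ip ell2 (\<Sum>i\<in>I. f i) v = (\<Sum>i\<in>I. ip ell2 (f i) v)"
  using assms(1)
proof (induction I rule: infinite_finite_induct)
  case (insert i I)
  interpret hilbert_space ell2 by (rule hilbert_ell2)
  have "(\<Sum>i\<in>I. f i) \<in> l2" using insert by (intro l2_sum) auto
  then show ?case
    using insert assms(2) ip_add[of "f i" "\<Sum>i\<in>I. f i" v] by (simp del: ell2_sel(3) plus_fun_apply)
qed (use assms(2) l2_zero in \<open>simp_all\<close>)

section \<open>The symbol and its Haagerup representation\<close>

definition unit_mask :: "nat \<Rightarrow> real \<Rightarrow> complex" where
  "unit_mask j = indicator {real j}"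

text \<open>Only the values at natural numbers, the atoms of the spectral measure, affect the
  integral; \<open>nat \<lfloor>x\<rfloor>\<close> extends the signs of row \<open>j\<close> to a
  Borel function on the line.\<close>

definition sign_coeff :: "nat \<Rightarrow> nat \<Rightarrow> real \<Rightarrow> complex" where
  "sign_coeff j k x = (if j = k then of_real (sgn (had j (nat \<lfloor>x\<rfloor>))) else 0)"

definition symbol :: "real \<Rightarrow> real \<Rightarrow> real \<Rightarrow> complex" where
  "symbol x y z = (\<Sum>j. unit_mask j x * sign_coeff j j y * unit_mask j z)"

text \<open>At each \<open>x\<close> at most one mask is nonzero, so the bound 1 holds everywhere
  and the empty set serves as exceptional set.\<close>

lemma unit_mask_Linf:
  assumes "{} \<in> spectral_null ell2 E"
  shows "unit_mask \<in> Linf_l2 ell2 E"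
proof -
  have "L2_set (\<lambda>j. cmod (unit_mask j x)) {..<N} \<le> 1" for x N
  proof -
    have "(\<Sum>j<N. (cmod (unit_mask j x))\<^sup>2) \<le> (\<Sum>j<N. if j = nat \<lfloor>x\<rfloor> then 1 else 0)"
      by (intro sum_mono) (auto simp: unit_mask_def indicator_def)
    also have "\<dots> \<le> 1" by (simp add: sum.delta)
    finally show ?thesis by (simp add: L2_set_def)
  qed
  then have "(\<lambda>j. unit_mask j x) \<in> l2" "l2_norm (\<lambda>j. unit_mask j x) \<le> 1" for x
    by (rule l2_boundI)+
  moreover have "unit_mask j \<in> borel_measurable borel" for j
    unfolding unit_mask_def by simp
  ultimately show ?thesis
    unfolding Linf_l2_def spectral_ae_def using assms by blast
qed

lemma sign_coeff_norm: "cmod (sign_coeff j k x) \<le> 1"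
  by (auto simp: sign_coeff_def sgn_if)

lemma sign_coeff_measurable [measurable]: "sign_coeff j k \<in> borel_measurable borel"
proof -
  have "(\<lambda>x::real. nat \<lfloor>x\<rfloor>) \<in> measurable borel (count_space UNIV)" by measurable
  then have "(\<lambda>x::real. complex_of_real (sgn (had j (nat \<lfloor>x\<rfloor>)))) \<in> borel_measurable borel"
    by (rule measurable_compose[where g = "\<lambda>i. complex_of_real (sgn (had j i))"]) simp
  then show ?thesis unfolding sign_coeff_def by (cases "j = k") simp_all
qed

lemma sign_coeff_Linf:
  assumes "{} \<in> spectral_null ell2 E"
  shows "sign_coeff \<in> Linf_matrices ell2 E"
proof -
  have app: "(\<lambda>k. sign_coeff j k x * z k) sums (sign_coeff j j x * z j)" for j x z
    using sums_finite[of "{j}" "\<lambda>k. sign_coeff j k x * z k"] by (auto simp: sign_coeff_def)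
  have mat: "mat_app (\<lambda>j k. sign_coeff j k x) z = (\<lambda>j. sign_coeff j j x * z j)" for x z
    unfolding mat_app_def using app by (auto simp: sums_iff)
  have l2: "mat_app (\<lambda>j k. sign_coeff j k x) z \<in> l2"
    "l2_norm (mat_app (\<lambda>j k. sign_coeff j k x) z) \<le> 1 * l2_norm z" if "z \<in> l2" for x z
    unfolding mat by (rule l2_bounded_mult[OF that sign_coeff_norm])+
  then have "(\<lambda>j k. sign_coeff j k x) \<in> bounded_matrices" for x
    unfolding bounded_matrices_def
    by (intro CollectI conjI exI[of _ 1] ballI allI sums_summable[OF app] l2)
  moreover have "matrix_norm (\<lambda>j k. sign_coeff j k x) \<le> 1" for x
    unfolding matrix_norm_def
  proof (rule cSup_least)
    show "{l2_norm (mat_app (\<lambda>j k. sign_coeff j k x) z) |z. z \<in> l2 \<and> l2_norm z \<le> 1} \<noteq> {}"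
      using l2_zero by (auto intro: exI[of _ 0])
  qed (use l2(2) in \<open>fastforce intro: order_trans\<close>)
  ultimately show ?thesis
    unfolding Linf_matrices_def spectral_ae_def using assms sign_coeff_measurable by blast
qed

lemma symbol_representation:
  assumes "{} \<in> spectral_null ell2 E1" "{} \<in> spectral_null ell2 E2" "{} \<in> spectral_null ell2 E3"
  shows "haagerup_representation ell2 E1 E2 E3 symbol unit_mask sign_coeff unit_mask"
proof -
  have "((\<lambda>(M, N). \<Sum>j\<le>M. \<Sum>k\<le>N. unit_mask j x * sign_coeff j k y * unit_mask k z) \<longlongrightarrow> symbol x y z)
      (sequentially \<times>\<^sub>F sequentially)" for x y z
  proof -
    let ?t = "\<lambda>j. unit_mask j x * sign_coeff j j y * unit_mask j z"
    \<comment> \<open>At most the mask with index \<open>nat \<lfloor>x\<rfloor>\<close> is nonzero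
      at \<open>x\<close>, so the series is finite.\<close>
    have "summable ?t"
      by (rule summable_finite[of "{nat \<lfloor>x\<rfloor>}"]) (auto simp: unit_mask_def indicator_def)
    then have "?t sums symbol x y z" unfolding symbol_def by (rule summable_sums)
    moreover have "(if j = k then ?t j else 0) = unit_mask j x * sign_coeff j k y * unit_mask k z" for j k
      by (simp add: sign_coeff_def)
    ultimately show ?thesis using tendsto_diagonal_sums[of ?t "symbol x y z"] by simp
  qed
  then show ?thesis
    unfolding haagerup_representation_def
    using assms by (auto simp: unit_mask_Linf sign_coeff_Linf intro!: bexI[of _ "{}"])
qed

text \<open>The exponent has to satisfy \<open>1/2 < s < 1/(2p) + 1/4\<close>, which is possible exactly for \<open>p < 2\<close>:
  the lower bound makes the sequence square summable, and the upper bound keeps the products of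
  the block sizes \<open>2^k\<close> with the \<open>p\<close>-th powers of the eigenvalues unbounded.\<close>

definition decay :: "real \<Rightarrow> nat \<Rightarrow> real" where
  "decay s n = real (n + 1) powr - s"

lemma decay_pos: "0 < decay s n"
  by (simp add: decay_def)

lemma decay_l2:
  assumes "1 / 2 < s"
  shows "(\<lambda>n. of_real (decay s n)) \<in> l2"
proof -
  have "summable (\<lambda>n. real n powr (- 2 * s))"
    using assms by (simp add: summable_real_powr_iff)
  then have "summable (\<lambda>n. real (n + 1) powr (- 2 * s))"
    by (subst summable_iff_shift)
  moreover have "(decay s n)\<^sup>2 = real (n + 1) powr (- 2 * s)" for n
    by (simp add: decay_def powr_power mult.commute)
  ultimately show ?thesis by (simp add: l2_def)
qed

text \<open>This is the product of \<open>decay s j\<close> and the sum of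
  \<open>\<bar>had j n\<bar> * decay s n\<close> over \<open>n\<close>, since row \<open>j\<close>
  meets its own signs. Written with \<open>had_op\<close> it has the form in which it leaves the
  triple integral.\<close>

definition eigenvalue :: "real \<Rightarrow> nat \<Rightarrow> complex" where
  "eigenvalue s j = of_real (decay s j) * had_op (\<lambda>n. of_real (sgn (had j n) * decay s n)) j"

text \<open>Signs do not increase the norm and \<open>had_op\<close> is isometric, so each of the
  two factors is at most the norm of the decay sequence.\<close>

lemma eigenvalue_bounded:
  assumes "1 / 2 < s"
  shows "cmod (eigenvalue s j) \<le> (l2_norm (\<lambda>n. of_real (decay s n)))\<^sup>2"
proof -
  let ?q = "\<lambda>n. complex_of_real (decay s n)"
  let ?f = "\<lambda>n. complex_of_real (sgn (had j n)) * ?q n"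
  have q: "?q \<in> l2" using assms by (rule decay_l2)
  have "cmod (complex_of_real (sgn (had j n))) \<le> 1" for n by (simp add: sgn_if)
  then have f: "?f \<in> l2" "l2_norm ?f \<le> 1 * l2_norm ?q"
    by (rule l2_bounded_mult[OF q])+
  have "cmod (had_op ?f j) \<le> l2_norm (had_op ?f)"
    using f(1) by (intro cmod_le_l2_norm had_op_l2)
  also have "\<dots> = l2_norm ?f"
    using l2_involution_had f(1) by (rule l2_involution.V_norm)
  finally have "cmod (had_op ?f j) \<le> l2_norm ?q" using f(2) by simp
  moreover have "cmod (?q j) \<le> l2_norm ?q" using q by (rule cmod_le_l2_norm)
  ultimately show ?thesis
    unfolding eigenvalue_def norm_mult power2_eq_square of_real_mult
    by (intro mult_mono l2_norm_nonneg[OF q]) auto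
qed

text \<open>The \<open>2 ^ k\<close> entries of row \<open>j\<close> in its block have modulus
  \<open>2 powr - (k / 2)\<close>, and both decay factors are at least
  \<open>2 powr - ((k + 1) * s)\<close>; multiplying out gives the bound. The terms outside the
  block are nonnegative and are dropped.\<close>

lemma eigenvalue_ge:
  assumes "0 \<le> s" and j: "j \<in> {2 ^ k..<2 ^ Suc k}"
  shows "2 powr (real k / 2 - 2 * (real k + 1) * s) \<le> cmod (eigenvalue s j)"
proof -
  let ?I = "{2 ^ k..<2 ^ Suc k} :: nat set"
  have le: "2 powr - ((k + 1) * s) \<le> decay s n" if "n \<in> ?I" for n
  proof -
    \<comment> \<open>The shift by one in \<open>decay\<close> costs nothing:
      \<open>n < 2 ^ Suc k\<close> gives \<open>n + 1 \<le> 2 ^ Suc k\<close>.\<close>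
    have "real (n + 1) \<le> real (2 ^ Suc k)" using that by (intro of_nat_mono) simp
    also have "\<dots> = 2 powr (real k + 1)" by (simp add: powr_add powr_realpow)
    finally have "(2 powr (real k + 1)) powr - s \<le> real (n + 1) powr - s"
      using assms(1) by (intro powr_mono2') auto
    then show ?thesis by (simp add: decay_def powr_powr add.commute)
  qed
  have "j < 2 ^ j" by (rule less_exp)
  \<comment> \<open>Since \<open>k < 2 ^ k \<le> j\<close>, the cut-off \<open>2 ^ j\<close> used to
    evaluate row \<open>j\<close> leaves the whole block inside the sum.\<close>
  have "k < 2 ^ k" by (rule less_exp)
  also have "2 ^ k \<le> j" using j by simp
  finally have "k < j" .
  then have sub: "?I \<subseteq> {..<2 ^ j}"
    using power_increasing[of "Suc k" j "2::nat"] by auto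
  have nonneg: "0 \<le> \<bar>had j n\<bar> * decay s n" for n
    using decay_pos[of s n] by simp
  have summand: "2 powr - (k / 2) * 2 powr - ((k + 1) * s) \<le> \<bar>had j n\<bar> * decay s n" if "n \<in> ?I" for n
  proof -
    have "\<bar>had j n\<bar> = 1 / sqrt (2 ^ k)" using that j by (intro abs_had) auto
    also have "\<dots> = 2 powr - (k / 2)" by (simp add: powr_minus_divide powr_half_sqrt_powr powr_realpow)
    finally show ?thesis using le[OF that] by simp
  qed
  have "2 powr (k / 2 - (k + 1) * s) = (\<Sum>n\<in>?I. 2 powr - (k / 2) * 2 powr - ((k + 1) * s))"
    by (simp add: powr_realpow[symmetric] powr_add[symmetric] algebra_simps)
  also have "\<dots> \<le> (\<Sum>n\<in>?I. \<bar>had j n\<bar> * decay s n)"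
    by (intro sum_mono summand)
  also have "\<dots> \<le> (\<Sum>n<2 ^ j. \<bar>had j n\<bar> * decay s n)"
    using sub nonneg by (intro sum_mono2) auto
  finally have c: "2 powr (k / 2 - (k + 1) * s) \<le> (\<Sum>n<2 ^ j. \<bar>had j n\<bar> * decay s n)" .
  have "had_op (\<lambda>n. of_real (sgn (had j n) * decay s n)) j = of_real (\<Sum>n<2 ^ j. \<bar>had j n\<bar> * decay s n)"
    unfolding had_op_eq[OF \<open>j < 2 ^ j\<close>] of_real_sum
    by (intro sum.cong refl) (simp add: abs_sgn mult_ac)
  moreover have "0 \<le> (\<Sum>n<2 ^ j. \<bar>had j n\<bar> * decay s n)" by (intro sum_nonneg nonneg)
  ultimately have ev: "cmod (eigenvalue s j) = decay s j * (\<Sum>n<2 ^ j. \<bar>had j n\<bar> * decay s n)"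
    using decay_pos[of s j] by (simp only: eigenvalue_def norm_mult norm_of_real abs_of_nonneg less_imp_le)
  have "2 powr (real k / 2 - 2 * (real k + 1) * s) = 2 powr - ((k + 1) * s) * 2 powr (k / 2 - (k + 1) * s)"
    by (simp add: powr_add[symmetric] algebra_simps)
  also have "\<dots> \<le> cmod (eigenvalue s j)"
    unfolding ev using le[OF j] c decay_pos[of s j] by (intro mult_mono) auto
  finally show ?thesis .
qed

text \<open>Each block yields \<open>2 ^ k\<close> eigenvalues of modulus at least
  \<open>?\<delta> k\<close>, hence as many singular values of at least that size. Their
  contribution to the Schatten series grows exponentially in \<open>k\<close>, so the series
  diverges.\<close>

lemma diag_eigenvalue_not_Schatten:
  assumes s: "1 / 2 < s" "s < 1 / (2 * p) + 1 / 4" and p: "0 < p"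
  shows "(\<lambda>u n. eigenvalue s n * u n) \<notin> Schatten ell2 p"
proof
  let ?W = "\<lambda>u n. eigenvalue s n * u n"
  let ?\<delta> = "\<lambda>k::nat. 2 powr (k / 2 - 2 * (k + 1) * s)"
  assume "?W \<in> Schatten ell2 p"
  then have sm: "summable (\<lambda>n. singular_value ell2 ?W n powr p)" by (simp add: Schatten_def)
  define S where "S = (\<Sum>n. singular_value ell2 ?W n powr p)"
  \<comment> \<open>The growth exponent: \<open>2 ^ k\<close> terms of size
    \<open>?\<delta> k powr p\<close> add up to \<open>2 powr (a * k - 2 * p * s)\<close>. The upper
    bound on \<open>s\<close> says exactly that \<open>a\<close> is positive.\<close>
  define a where "a = 1 + p / 2 - 2 * p * s"
  have "p * s < p * (1 / (2 * p) + 1 / 4)" using s p by (intro mult_strict_left_mono)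
  also have "\<dots> = 1 / 2 + p / 4" using p by (simp add: field_simps)
  finally have a: "a > 0" by (simp add: a_def)
  have bound: "2 powr (a * k - 2 * p * s) \<le> S" for k :: nat
  proof -
    have "2 powr (a * k - 2 * p * s) = (\<Sum>n<(2::nat) ^ k. ?\<delta> k powr p)"
      by (simp add: powr_powr powr_realpow[symmetric] powr_add[symmetric] a_def algebra_simps)
    also have "\<dots> \<le> (\<Sum>n<2 ^ k. singular_value ell2 ?W n powr p)"
    proof (intro sum_mono powr_mono2)
      fix n :: nat assume "n \<in> {..<2 ^ k}"
      \<comment> \<open>The block has \<open>2 ^ k\<close> elements, more than any \<open>n\<close>
        in the range of the sum.\<close>
      then show "?\<delta> k \<le> singular_value ell2 ?W n"
        using s eigenvalue_bounded[OF s(1)]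
        by (intro singular_value_diag_ge[where J = "{2 ^ k..<2 ^ Suc k}"] eigenvalue_ge) auto
    qed (use p in auto)
    also have "\<dots> \<le> S" unfolding S_def by (intro sum_le_suminf sm) auto
    finally show ?thesis .
  qed
  have "0 < S" using bound[of 0] by (rule less_le_trans[rotated]) simp
  obtain k :: nat where "(log 2 S + 2 * p * s) / a < k" using reals_Archimedean2 by blast
  then have "log 2 S < a * k - 2 * p * s" using a by (simp add: field_simps)
  then have "S < 2 powr (a * k - 2 * p * s)" using \<open>0 < S\<close> by (simp add: log_less_iff)
  then show False using bound[of k] by simp
qed

section \<open>Evaluation of the triple operator integral\<close>

lemma (in l2_involution) spectral_null_spec_empty: "{} \<in> spectral_null ell2 spec"
  using V_0 by (simp add: spectral_null_def spec_def diag_op_def zero_fun_def)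

lemma spectral_integral_unit_mask:
  assumes "u \<in> l2"
  shows "spectral_integral ell2 (l2_involution.spec (\<lambda>u. u)) (unit_mask j) u =
    (\<lambda>n. if n = j then u n else 0)"
proof -
  interpret I: l2_involution "\<lambda>u. u" by (rule l2_involution_id)
  have "unit_mask j \<in> borel_measurable borel" unfolding unit_mask_def by simp
  moreover have "cmod (unit_mask j x) \<le> 1" for x by (simp add: unit_mask_def indicator_def)
  ultimately have "spectral_integral ell2 I.spec (unit_mask j) u = I.diag_op (\<lambda>n. unit_mask j (real n)) u"
    by (rule I.spectral_integral_spec[OF assms])
  then show ?thesis by (auto simp: I.diag_op_def unit_mask_def indicator_def)
qed

lemma spectral_integral_sign_coeff:
  assumes "u \<in> l2"
  shows "spectral_integral ell2 (l2_involution.spec had_op) (sign_coeff j k) u =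
    (if j = k then had_op (\<lambda>n. of_real (sgn (had j n)) * had_op u n) else 0)"
proof -
  interpret H: l2_involution had_op by (rule l2_involution_had)
  have "spectral_integral ell2 H.spec (sign_coeff j k) u = H.diag_op (\<lambda>n. sign_coeff j k (real n)) u"
    by (rule H.spectral_integral_spec[OF assms sign_coeff_measurable sign_coeff_norm])
  then show ?thesis using H.V_0 by (simp add: H.diag_op_def sign_coeff_def zero_fun_def)
qed

text \<open>From right to left: the mask keeps coordinate \<open>k\<close> of \<open>u\<close>, the
  rank one operator turns it into a multiple of \<open>had_op q\<close>, the middle integral
  restores \<open>q\<close>, multiplies it by the signs of row \<open>j\<close> and applies
  \<open>had_op\<close> again, and the last mask reads off coordinate \<open>j\<close>. Off the
  diagonal the middle integral is zero.\<close>

lemma triple_term: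
  assumes s: "1 / 2 < s" and u: "u \<in> l2"
  defines "q \<equiv> \<lambda>n. complex_of_real (decay s n)"
  defines "E \<equiv> l2_involution.spec (\<lambda>u. u)"
  shows "spectral_integral ell2 E (unit_mask j)
      (spectral_integral ell2 (l2_involution.spec had_op) (sign_coeff j k)
        (rank_one q (had_op q) (spectral_integral ell2 E (unit_mask k) u))) =
    (if j = k then \<lambda>n. if n = j then eigenvalue s j * u j else 0 else 0)"
proof -
  have q: "q \<in> l2" unfolding q_def using s by (rule decay_l2)
  let ?u = "\<lambda>n. if n = k then u n else 0"
  have l2: "?u \<in> l2" using l2_dominated(1)[OF u, of 1 ?u] by simp
  have "ip ell2 ?u q = u k * q k"
    using l2 q suminf_finite[of "{k}" "\<lambda>n. ?u n * cnj (q n)"] by (simp add: q_def)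
  then have Q: "rank_one q (had_op q) ?u = (\<lambda>n. (u k * q k) * had_op q n)"
    by (simp add: rank_one_def del: ell2_sel(3))
  have Ql2: "(\<lambda>n. (u k * q k) * had_op q n) \<in> l2"
    by (intro l2_scale had_op_l2 q)
  let ?f = "\<lambda>n. of_real (sgn (had j n)) * had_op (\<lambda>n. (u k * q k) * had_op q n) n"
  \<comment> \<open>The inner \<open>had_op\<close> cancels against the one in the range vector of
    the rank one operator, so the signs act on \<open>q\<close> itself.\<close>
  have "?f = (\<lambda>n. (u k * q k) * of_real (sgn (had j n) * decay s n))"
    by (auto simp: had_op_scale had_op_involution q_def)
  then have f: "had_op ?f = (\<lambda>n. (u k * q k) * had_op (\<lambda>n. of_real (sgn (had j n) * decay s n)) n)"
    by (simp only: had_op_scale)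
  have "?f \<in> l2"
    by (rule l2_bounded_mult(1)[where C = 1]) (use Ql2 in \<open>auto simp: sgn_if intro: had_op_l2\<close>)
  then have "had_op ?f \<in> l2" by (rule had_op_l2)
  then have "(if j = k then had_op ?f else 0) \<in> l2" using l2_zero(1) by (cases "j = k") simp_all
  then have "spectral_integral ell2 E (unit_mask j)
      (spectral_integral ell2 (l2_involution.spec had_op) (sign_coeff j k)
        (rank_one q (had_op q) (spectral_integral ell2 E (unit_mask k) u))) =
      (\<lambda>n. if n = j then (if j = k then had_op ?f else 0) n else 0)"
    unfolding E_def spectral_integral_unit_mask[OF u] Q spectral_integral_sign_coeff[OF Ql2]
    by (rule spectral_integral_unit_mask)
  then show ?thesis unfolding f by (auto simp: eigenvalue_def q_def)
qed

theorem theorem4p2: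
  fixes p :: real
  assumes "1 \<le> p" and "p < 2"
  shows "\<exists>(H :: (nat \<Rightarrow> complex) hilbert) E1 E2 E3 \<Psi> Q W.
    hilbert_space H \<and>
    spectral_measure H E1 \<and> spectral_measure H E2 \<and> spectral_measure H E3 \<and>
    \<Psi> \<in> haagerup_tensor H E1 E2 E3 \<and>
    Q \<in> Schatten H p \<and>
    has_triple_integral H E1 (\<lambda>u. u) E2 Q E3 \<Psi> W \<and>
    W \<notin> Schatten H p"
proof -
  interpret I: l2_involution "\<lambda>u. u" by (rule l2_involution_id)
  interpret H: l2_involution had_op by (rule l2_involution_had)
  have "1 / 2 < 1 / (2 * p) + 1 / 4" using assms by (simp add: field_simps)
  then obtain s where s: "1 / 2 < s" "s < 1 / (2 * p) + 1 / 4" using dense by blast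
  define q where "q = (\<lambda>n. complex_of_real (decay s n))"
  have q: "q \<in> l2" unfolding q_def using s(1) by (rule decay_l2)
  define W where "W = (\<lambda>u n. eigenvalue s n * u n)"
  have W: "bounded_op ell2 W"
    unfolding W_def by (rule bounded_op_diag, rule eigenvalue_bounded[OF s(1)])
  have rep: "haagerup_representation ell2 I.spec H.spec I.spec symbol unit_mask sign_coeff unit_mask"
    by (intro symbol_representation I.spectral_null_spec_empty H.spectral_null_spec_empty)
  have lim: "((\<lambda>(M, N). ip ell2 (\<Sum>j\<le>M. \<Sum>k\<le>N.
        spectral_integral ell2 I.spec (unit_mask j) (spectral_integral ell2 H.spec (sign_coeff j k)
          (rank_one q (had_op q) (spectral_integral ell2 I.spec (unit_mask k) u)))) v) \<longlongrightarrow> ip ell2 (W u) v)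
      (sequentially \<times>\<^sub>F sequentially)" if u: "u \<in> l2" and v: "v \<in> l2" for u v
  proof -
    let ?D = "\<lambda>j k n. if j = k then if n = j then eigenvalue s j * u j else 0 else 0"
    \<comment> \<open>This is the \<open>j\<close>-th term of the series for
      \<open>ip ell2 (W u) v\<close>; in the rectangular sums it stands on the diagonal, and all
      other entries vanish.\<close>
    let ?t = "\<lambda>j. W u j * cnj (v j)"
    have D: "spectral_integral ell2 I.spec (unit_mask j) (spectral_integral ell2 H.spec (sign_coeff j k)
          (rank_one q (had_op q) (spectral_integral ell2 I.spec (unit_mask k) u))) = ?D j k" for j k
      using triple_term[OF s(1) u, of j k] unfolding q_def by (auto simp: fun_eq_iff)
    have Wu: "W u \<in> l2" using W u by (rule bounded_opD(1))
    have D_l2: "?D j k \<in> l2" for j k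
      using l2_dominated(1)[OF Wu, of 1 "?D j k"] by (simp add: W_def)
    have ipD: "ip ell2 (?D j k) v = (if j = k then ?t j else 0)" for j k
      using D_l2[of j k] v suminf_finite[of "{j}" "\<lambda>n. ?D j k n * cnj (v n)"] by (auto simp: W_def)
    have "ip ell2 (\<Sum>j\<le>M. \<Sum>k\<le>N. ?D j k) v = (\<Sum>j\<le>M. \<Sum>k\<le>N. if j = k then ?t j else 0)" for M N
      using D_l2 v by (simp only: ip_sum_ell2 l2_sum ipD)
    moreover have "?t sums ip ell2 (W u) v"
      using summable_sums[OF summable_ip(1)[OF Wu v]] Wu v by simp
    ultimately show ?thesis unfolding D using tendsto_diagonal_sums by simp
  qed
  show ?thesis
  proof (intro exI conjI)
    show "hilbert_space ell2" by (rule hilbert_ell2)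
    show "spectral_measure ell2 I.spec" "spectral_measure ell2 H.spec" "spectral_measure ell2 I.spec"
      by (rule I.spectral_measure_spec H.spectral_measure_spec)+
    show "symbol \<in> haagerup_tensor ell2 I.spec H.spec I.spec"
      unfolding haagerup_tensor_def using rep by blast
    show "rank_one q (had_op q) \<in> Schatten ell2 p"
      using assms by (intro rank_one_Schatten had_op_l2 q) auto
    show "has_triple_integral ell2 I.spec (\<lambda>u. u) H.spec (rank_one q (had_op q)) I.spec symbol W"
      unfolding has_triple_integral_def ell2_sel(1) using W rep lim by blast
    show "W \<notin> Schatten ell2 p"
      unfolding W_def using s assms by (intro diag_eigenvalue_not_Schatten) auto
  qed
qed

end
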